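(* Let $S_n^2$ denote the $n$-dimensional split-star. Then for all $n\geqslant 4$, $\kappa_3(S_n^2)=4n-8$, $\kappa_4(S_n^2)=6n-14$, and $\kappa_5(S_n^2)=8n-20$.
   Context: For an integer $\ell\geqslant 2$, the $\ell$-component connectivity $\kappa_\ell(G)$ of a graph $G$ is the minimum number of vertices whose removal from $G$ results in a disconnected graph with at least $\ell$ components or a graph with fewer than $\ell$ vertices. For $n\geqslant 3$, permutations $p=p_1p_2\cdots p_n$ of $\{1,\dots,n\}$ are written as words; $\mathcal S_n$ is the set of all permutations. $p\,\mathrm{g}_{12}$ is obtained from $p$ by swapping the symbols at positions $1$ and $2$. For $3\leqslant i\leqslant n$, $p\,\mathrm{g}_i^+$ is obtained from $p$ by placing $p_i,p_1,p_2$ at positions $1,2,i$ respectively (other positions unchanged), and $p\,\mathrm{g}_i^-$ by placing $p_2,p_i,p_1$ at positions $1,2,i$ respectively. The split-star $S_n^2$ has vertex set $\mathcal S_n$, with $p,q$ adjacent iff $q=p\mathrm{g}_{12}$ or $q\in\{p\mathrm{g}_i^+,p\mathrm{g}_i^-\}$ for some $i\in\{3,\dots,n\}$. *)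

theory Defs
  imports "HOL-Combinatorics.Multiset_Permutations"
begin

definition reach_del :: "'a set \<Rightarrow> ('a \<Rightarrow> 'a \<Rightarrow> bool) \<Rightarrow> 'a set \<Rightarrow> 'a \<Rightarrow> 'a \<Rightarrow> bool" where
  "reach_del V E F = (\<lambda>x y. x \<in> V - F \<and> y \<in> V - F \<and> E x y)\<^sup>*\<^sup>*"

definition components_del :: "'a set \<Rightarrow> ('a \<Rightarrow> 'a \<Rightarrow> bool) \<Rightarrow> 'a set \<Rightarrow> 'a set set" where
  "components_del V E F = (V - F) // {(x, y). reach_del V E F x y}"

definition comp_conn :: "nat \<Rightarrow> 'a set \<Rightarrow> ('a \<Rightarrow> 'a \<Rightarrow> bool) \<Rightarrow> nat" where
  "comp_conn l V E = (LEAST k. \<exists>F. F \<subseteq> V \<and> card F = k \<and>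
      (card (components_del V E F) \<ge> l \<or> card (V - F) < l))"

text \<open>Permutations as words p = p_1 ... p_n are lists; list index j is position j+1.\<close>
definition g12 :: "nat list \<Rightarrow> nat list" where
  "g12 p = p[0 := p ! 1, 1 := p ! 0]"

definition gplus :: "nat \<Rightarrow> nat list \<Rightarrow> nat list" where
  "gplus i p = p[0 := p ! (i - 1), 1 := p ! 0, i - 1 := p ! 1]"

definition gminus :: "nat \<Rightarrow> nat list \<Rightarrow> nat list" where
  "gminus i p = p[0 := p ! 1, 1 := p ! (i - 1), i - 1 := p ! 0]"

definition split_star_V :: "nat \<Rightarrow> nat list set" where
  "split_star_V n = permutations_of_set {1..n}"

definition split_star_E :: "nat \<Rightarrow> nat list \<Rightarrow> nat list \<Rightarrow> bool" where
  "split_star_E n p q \<longleftrightarrow> q = g12 p \<or> (\<exists>i \<in> {3..n}. q = gplus i p \<or> q = gminus i p)"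

end

theory Submission
  imports Defs
begin

text \<open>Put \<open>m = n - 2\<close>. Forgetting the first two symbols of a permutation and remembering its parity
  identifies the split-star with the Cartesian product of an edge and the graph on the injective words
  of length \<open>m\<close> over \<open>n = m + 2\<close> symbols, two words being adjacent if they differ in exactly one
  position (the alternating group graph). A vertex set leaves at least \<open>l\<close> components iff the
  surviving vertices carry a labelling with \<open>l\<close> values that is constant along edges, and labellings
  restrict to subgraphs without any bookkeeping of paths.

  In one layer closed neighbourhoods have \<open>2m + 1\<close> elements and those of non-adjacent words meet in at
  most two, so \<open>k\<close> independent words have at least \<open>(2m - 2)k + 4\<close> words in their closed
  neighbourhood for \<open>k = 2, 3, 4\<close>. If the layer with fewer faults carries one label only, the classes
  \<open>B\<close> not meeting it live in the other layer, the faults contain a copy of \<open>B\<close> in the first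
  layer and the boundary of \<open>B\<close> in the second, hence they are at least as many as the closed
  neighbourhood of \<open>B\<close>; this works no matter how large \<open>B\<close> is. Otherwise, the
  first layer has at least \<open>2m\<close> faults, and splitting words by their first symbol shows that it is
  connected apart from a single word \<open>v\<close>, whose \<open>2m\<close> faulty neighbours make up for the label lost
  to \<open>v\<close>; the exceptions are \<open>m = 2\<close> and \<open>4m - 3\<close> faults, where counting the labels of both layers
  suffices.\<close>

section \<open>Injective words and their neighbourhoods\<close>

text \<open>With \<open>k = l - 1\<close> the three values read \<open>(2 * n - 6) * k + 4\<close>.
  This is \<open>k * (2 * n - 3)\<close> minus \<open>3 * k - 4\<close>: the neighbours of
  \<open>k\<close> pairwise non-adjacent vertices of degree \<open>2 * n - 3\<close>, with 2, 5 or 8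
  deducted for sharing. For \<open>n = m + 2\<close> it is the bound for closed neighbourhoods in
  one layer. The obstacle is a first layer with two labels. Only \<open>k - 1\<close> labels are
  then guaranteed to avoid it, and the bound falls short by \<open>2 * m - 2\<close>. If the
  exceptional word \<open>v\<close> is faulty in the second layer, its \<open>2 * m\<close> faulty
  neighbours cover this with a slack of only 2, and those that are also copies of words of
  \<open>B\<close> are counted twice. Two coincidences are harmless; from three on, the closed
  neighbourhood of \<open>B\<close> must be shown to be larger, which is the purpose of the study of
  the neighbours of a fixed word. For \<open>k = 4\<close> nothing is left to spare there, so
  coincidences that are adjacent to each other need one more word.\<close>

definition words :: "'a set \<Rightarrow> nat \<Rightarrow> 'a list set" where
  "words S m = {w. length w = m \<and> distinct w \<and> set w \<subseteq> S}"

text \<open>The position \<open>i\<close> is unbounded and may lie outside the word, so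
  \<open>near\<close> is reflexive and \<open>nbhd\<close> is the closed neighbourhood.\<close>

definition near :: "'a list \<Rightarrow> 'a list \<Rightarrow> bool" where
  "near w z \<longleftrightarrow> length w = length z \<and> (\<exists>i. \<forall>j<length w. j \<noteq> i \<longrightarrow> w ! j = z ! j)"

definition nbhd :: "'a set \<Rightarrow> 'a list \<Rightarrow> 'a list set" where
  "nbhd S w = {z \<in> words S (length w). near w z}"

definition labelling :: "'a set \<Rightarrow> nat \<Rightarrow> 'a list set \<Rightarrow> ('a list \<Rightarrow> 'b) \<Rightarrow> bool" where
  "labelling S m F f \<longleftrightarrow> (\<forall>w\<in>words S m - F. \<forall>z\<in>words S m - F. near w z \<longrightarrow> f w = f z)"

lemma nth_update_if: "j < length w \<Longrightarrow> w[i := x] ! j = (if i = j then x else w ! j)"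
  by auto

lemma near_refl [simp]: "near w w"
  by (auto simp: near_def)

lemma near_sym: "near w z \<longleftrightarrow> near z w"
  unfolding near_def by metis

lemma near_update [simp]: "near w (w[i := x])"
  unfolding near_def by (auto intro!: exI[of _ i] simp: nth_list_update)

lemma near_Cons_same [simp]: "near (s # u) (s # v) \<longleftrightarrow> near u v"
proof
  assume "near (s # u) (s # v)"
  then obtain i where i: "length u = length v" "\<forall>j<Suc (length u). j \<noteq> i \<longrightarrow> (s # u) ! j = (s # v) ! j"
    by (auto simp: near_def)
  show "near u v"
  proof (cases i)
    case 0
    then have "\<forall>j<length u. u ! j = v ! j" using i(2) by (metis Suc_less_eq nat.distinct(1) nth_Cons_Suc)
    then show ?thesis using i(1) by (auto simp: near_def)
  next
    case (Suc i')
    then have "\<forall>j<length u. j \<noteq> i' \<longrightarrow> u ! j = v ! j" using i(2) by (metis Suc_less_eq nat.inject nth_Cons_Suc)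
    then show ?thesis using i(1) by (auto simp: near_def)
  qed
next
  assume "near u v"
  then obtain i where i: "length u = length v" "\<forall>j<length u. j \<noteq> i \<longrightarrow> u ! j = v ! j"
    by (auto simp: near_def)
  have "\<forall>j<Suc (length u). j \<noteq> Suc i \<longrightarrow> (s # u) ! j = (s # v) ! j"
    using i(2) by (auto simp: nth_Cons split: nat.split)
  then show "near (s # u) (s # v)" using i(1) by (auto simp: near_def)
qed

lemma near_Cons_tail [simp]: "near (s # u) (t # u)"
  unfolding near_def by (auto intro!: exI[of _ 0])

lemma finite_words [simp]: "finite S \<Longrightarrow> finite (words S m)"
  unfolding words_def by (rule finite_subset[OF _ finite_lists_length_eq[of S m]]) auto

lemma nbhd_subset_words: "w \<in> words S m \<Longrightarrow> nbhd S w \<subseteq> words S m"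
  by (auto simp: nbhd_def words_def)

lemma finite_nbhd [simp]: "finite S \<Longrightarrow> finite (nbhd S w)"
  by (simp add: nbhd_def)

lemma self_in_nbhd: "w \<in> words S m \<Longrightarrow> w \<in> nbhd S w"
  by (auto simp: nbhd_def words_def)

lemma mem_nbhd: "w \<in> words S m \<Longrightarrow> z \<in> nbhd S w \<longleftrightarrow> z \<in> words S m \<and> near w z"
  by (auto simp: nbhd_def words_def)

lemma nbhd_sym: "w \<in> words S m \<Longrightarrow> z \<in> words S m \<Longrightarrow> z \<in> nbhd S w \<longleftrightarrow> w \<in> nbhd S z"
  by (auto simp: nbhd_def words_def near_sym)

lemma update_in_words:
  assumes "w \<in> words S m" "x \<in> S - set w"
  shows "w[i := x] \<in> words S m"
  using assms set_update_subset_insert[of w i x] by (auto simp: words_def intro!: distinct_list_update)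

lemma update_in_wordsD:
  assumes "w \<in> words S m" "i < m" "w[i := x] \<in> words S m" "x \<noteq> w ! i"
  shows "x \<in> S - set w"
proof -
  have "x \<in> S" using assms set_update_memI[of i w x] by (auto simp: words_def)
  moreover have "x \<notin> set w"
  proof
    assume "x \<in> set w"
    then obtain j where j: "j < m" "w ! j = x" using assms(1) by (auto simp: in_set_conv_nth words_def)
    then have "j \<noteq> i" using assms(4) by auto
    then have "w[i := x] ! i = w[i := x] ! j" using j assms by (auto simp: words_def)
    moreover have "i < length (w[i := x])" "j < length (w[i := x])" "distinct (w[i := x])"
      using assms j by (auto simp: words_def)
    ultimately show False using \<open>j \<noteq> i\<close> nth_eq_iff_index_eq by blast
  qed
  ultimately show ?thesis by simp
qed

lemma near_imp_update:
  assumes "near w z" "w \<noteq> z"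
  obtains i where "i < length w" "z = w[i := z ! i]" "z ! i \<noteq> w ! i"
proof -
  obtain i where i: "length w = length z" "\<forall>j<length w. j \<noteq> i \<longrightarrow> w ! j = z ! j"
    using assms(1) by (auto simp: near_def)
  have e: "z = w[i := z ! i]" using i by (intro nth_equalityI) (auto simp: nth_update_if)
  then have "i < length w" using assms(2) by (metis linorder_not_less list_update_beyond)
  moreover have "z ! i \<noteq> w ! i" using e assms(2) by (metis list_update_id)
  ultimately show ?thesis using that e by blast
qed

lemma nbhd_eq:
  assumes "w \<in> words S m"
  shows "nbhd S w = insert w ((\<lambda>(i, x). w[i := x]) ` ({..<m} \<times> (S - set w)))"
proof (intro subset_antisym subsetI)
  fix z assume z: "z \<in> nbhd S w"
  then have zw: "z \<in> words S m" "near w z" using mem_nbhd[OF assms] by auto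
  show "z \<in> insert w ((\<lambda>(i, x). w[i := x]) ` ({..<m} \<times> (S - set w)))"
  proof (cases "w = z")
    case False
    then obtain i where i: "i < length w" "z = w[i := z ! i]" "z ! i \<noteq> w ! i"
      using near_imp_update zw(2) by blast
    then have "z ! i \<in> S - set w"
      using update_in_wordsD[OF assms, of i "z ! i"] zw(1) assms by (auto simp: words_def)
    then show ?thesis using i assms by (auto simp: words_def image_iff intro!: bexI[of _ "(i, z ! i)"])
  qed auto
next
  fix z assume "z \<in> insert w ((\<lambda>(i, x). w[i := x]) ` ({..<m} \<times> (S - set w)))"
  then show "z \<in> nbhd S w" using assms update_in_words[OF assms] by (auto simp: mem_nbhd[OF assms])
qed

section \<open>Sizes and overlaps of closed neighbourhoods\<close>

lemma card_unused:
  assumes "w \<in> words S m" "finite S" "card S = m + 2"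
  shows "card (S - set w) = 2"
  using assms by (subst card_Diff_subset) (auto simp: words_def distinct_card)

lemma update_eq_iff:
  assumes "i < length w" "j < length w" "x \<notin> set w" "y \<notin> set w"
  shows "w[i := x] = w[j := y] \<longleftrightarrow> i = j \<and> x = y"
proof
  assume e: "w[i := x] = w[j := y]"
  then have "w[i := x] ! i = w[j := y] ! i" by simp
  then show "i = j \<and> x = y" using assms by (cases "i = j") auto
qed auto

lemma card_nbhd:
  assumes "w \<in> words S m" "finite S" "card S = m + 2"
  shows "card (nbhd S w) = 2 * m + 1"
proof -
  have inj: "inj_on (\<lambda>(i, x). w[i := x]) ({..<m} \<times> (S - set w))"
    using assms by (auto simp: inj_on_def words_def update_eq_iff)
  have "w \<notin> (\<lambda>(i, x). w[i := x]) ` ({..<m} \<times> (S - set w))"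
  proof
    assume "w \<in> (\<lambda>(i, x). w[i := x]) ` ({..<m} \<times> (S - set w))"
    then obtain i x where "i < m" "x \<notin> set w" "w = w[i := x]" by auto
    moreover have "i < length w" using \<open>i < m\<close> assms(1) by (simp add: words_def)
    ultimately show False using set_update_memI[of i w x] by simp
  qed
  then show ?thesis using nbhd_eq[OF assms(1)] card_image[OF inj] card_unused[OF assms] assms(2)
    by (simp add: card_cartesian_product)
qed

text \<open>Words that agree off position \<open>i\<close> form a triangle. A change of
  \<open>x\<close> at another position \<open>j\<close> differs from \<open>x[i := a]\<close> at
  both \<open>i\<close> and \<open>j\<close>, so the common part is confined to this
  triangle.\<close>

lemma nbhd_overlap_adjacent:
  assumes "x \<in> words S m" "finite S" "card S = m + 2" "i < m" "a \<in> S - set x"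
  shows "nbhd S x \<inter> nbhd S (x[i := a]) = insert x ((\<lambda>c. x[i := c]) ` (S - set x))"
    and "card (nbhd S x \<inter> nbhd S (x[i := a])) = 3"
proof -
  let ?y = "x[i := a]"
  have y: "?y \<in> words S m" by (rule update_in_words[OF assms(1,5)])
  have l: "length x = m" using assms(1) by (simp add: words_def)
  show e: "nbhd S x \<inter> nbhd S ?y = insert x ((\<lambda>c. x[i := c]) ` (S - set x))" (is "?L = ?R")
  proof (intro subset_antisym subsetI)
    fix z assume z: "z \<in> ?L"
    show "z \<in> ?R"
    proof (cases "z = x")
      case False
      then obtain j c where j: "j < m" "c \<in> S - set x" "z = x[j := c]"
        using z nbhd_eq[OF assms(1)] by auto
      have "j = i"
      proof (rule ccontr)
        assume ne: "j \<noteq> i"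
        have "near ?y z" using z by (auto simp: nbhd_def)
        then obtain k where k: "\<forall>l<m. l \<noteq> k \<longrightarrow> ?y ! l = z ! l" using l by (auto simp: near_def)
        have 1: "?y ! i \<noteq> z ! i" using j ne assms l by auto
        have 2: "?y ! j \<noteq> z ! j" using j ne assms l by auto
        show False using k 1 2 ne assms(4) j(1) by metis
      qed
      then show ?thesis using j by auto
    qed auto
  next
    fix z assume z: "z \<in> ?R"
    then have "z \<in> words S m" using assms(1) update_in_words[OF assms(1)] by auto
    moreover have "near x z" using z by auto
    moreover have "near ?y z"
    proof -
      have "z = ?y[i := z ! i]" using z l assms(4) by auto
      then show ?thesis by (metis near_update)
    qed
    ultimately show "z \<in> ?L" using mem_nbhd[OF assms(1)] mem_nbhd[OF y] by auto
  qed
  have "inj_on (\<lambda>c. x[i := c]) (S - set x)" using assms l by (auto simp: inj_on_def update_eq_iff)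
  moreover have "x \<notin> (\<lambda>c. x[i := c]) ` (S - set x)"
    using assms l by (auto simp: image_iff) (metis set_update_memI)
  ultimately show "card (nbhd S x \<inter> nbhd S ?y) = 3"
    unfolding e using card_unused[OF assms(1-3)] assms(2) by (simp add: card_image)
qed

text \<open>A common neighbour is one change away from each of the non-adjacent words, so these
  differ in exactly two positions and \<open>z\<close> is the midpoint that makes the change at
  \<open>i\<close> first.\<close>

lemma nbhd_overlap_far:
  assumes "x \<in> words S m" "y \<in> words S m" "\<not> near x y" "z \<in> nbhd S x \<inter> nbhd S y"
  obtains i j where "i < m" "j < m" "i \<noteq> j" "x ! i \<noteq> y ! i" "x ! j \<noteq> y ! j"
    "y = x[i := y ! i, j := y ! j]" "z = x[i := y ! i]"
proof -
  have l: "length x = m" "length y = m" "length z = m" using assms by (auto simp: words_def nbhd_def)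
  obtain i where i: "\<forall>k<m. k \<noteq> i \<longrightarrow> x ! k = z ! k"
    using assms(4) l by (auto simp: nbhd_def near_def)
  obtain j where j: "\<forall>k<m. k \<noteq> j \<longrightarrow> y ! k = z ! k"
    using assms(4) l by (auto simp: nbhd_def near_def)
  have im: "i < m" and xi: "x ! i \<noteq> z ! i"
    using i j l assms(3) unfolding near_def by metis+
  have jm: "j < m" and yj: "y ! j \<noteq> z ! j"
    using i j l assms(3) unfolding near_def by metis+
  have ij: "i \<noteq> j" using i j l assms(3) unfolding near_def by metis
  show ?thesis
  proof
    show "i < m" "j < m" "i \<noteq> j" by fact+
    show "x ! i \<noteq> y ! i" using xi j im ij by auto
    show "x ! j \<noteq> y ! j" using yj i jm ij by auto
    show "y = x[i := y ! i, j := y ! j]"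
      using i j l by (intro nth_equalityI) (auto simp: nth_update_if)
    show "z = x[i := y ! i]" using i j l im ij by (intro nth_equalityI) (auto simp: nth_update_if)
  qed
qed

text \<open>There are two candidates for a midpoint, one for each order of the two changes.\<close>

lemma card_nbhd_overlap_far:
  assumes "x \<in> words S m" "y \<in> words S m" "\<not> near x y"
  shows "card (nbhd S x \<inter> nbhd S y) \<le> 2"
proof (cases "nbhd S x \<inter> nbhd S y = {}")
  case False
  then obtain z where "z \<in> nbhd S x \<inter> nbhd S y" by blast
  then obtain i j where ij: "y = x[i := y ! i, j := y ! j]"
    using nbhd_overlap_far[OF assms] by metis
  have "nbhd S x \<inter> nbhd S y \<subseteq> {x[i := y ! i], x[j := y ! j]}"
  proof
    fix q assume "q \<in> nbhd S x \<inter> nbhd S y"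
    then obtain k where k: "x ! k \<noteq> y ! k" "q = x[k := y ! k]"
      using nbhd_overlap_far[OF assms] by metis
    have "k = i \<or> k = j" using k(1) ij by (metis nth_list_update_neq)
    then show "q \<in> {x[i := y ! i], x[j := y ! j]}" using k(2) by auto
  qed
  then have "card (nbhd S x \<inter> nbhd S y) \<le> card {x[i := y ! i], x[j := y ! j]}" by (intro card_mono) auto
  also have "\<dots> \<le> 2" by (simp add: card_insert_if)
  finally show ?thesis .
qed auto

lemma nbhd_overlap_two:
  assumes "x \<in> words S m" "y \<in> words S m" "\<not> near x y" "card (nbhd S x \<inter> nbhd S y) = 2"
    and ab: "S - set x = {a, b}" "a \<noteq> b"
  obtains i j where "i < m" "j < m" "i \<noteq> j" "y = x[i := a, j := b]"
proof -
  have l: "length x = m" using assms(1) by (simp add: words_def)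
  have "nbhd S x \<inter> nbhd S y \<noteq> {}" using assms(4) by auto
  then obtain z where "z \<in> nbhd S x \<inter> nbhd S y" by blast
  then obtain i j where ij: "i < m" "j < m" "i \<noteq> j" "x ! i \<noteq> y ! i" "x ! j \<noteq> y ! j"
    "y = x[i := y ! i, j := y ! j]"
    using nbhd_overlap_far[OF assms(1-3)] by metis
  have sub: "nbhd S x \<inter> nbhd S y \<subseteq> {x[i := y ! i], x[j := y ! j]}"
  proof
    fix q assume "q \<in> nbhd S x \<inter> nbhd S y"
    then obtain k where k: "x ! k \<noteq> y ! k" "q = x[k := y ! k]"
      using nbhd_overlap_far[OF assms(1-3)] by metis
    have "k = i \<or> k = j" using k(1) ij(6) by (metis nth_list_update_neq)
    then show "q \<in> {x[i := y ! i], x[j := y ! j]}" using k(2) by auto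
  qed
  have "nbhd S x \<inter> nbhd S y = {x[i := y ! i], x[j := y ! j]}"
    by (rule card_seteq[OF _ sub]) (use assms(4) in \<open>auto simp: card_insert_if\<close>)
  then have "x[i := y ! i] \<in> words S m" "x[j := y ! j] \<in> words S m"
    using nbhd_subset_words[OF assms(1)] by blast+
  then have "y ! i \<in> {a, b}" "y ! j \<in> {a, b}"
    using update_in_wordsD[OF assms(1)] ij ab(1) by metis+
  moreover have "y ! i \<noteq> y ! j"
    using assms(2) ij by (auto simp: words_def nth_eq_iff_index_eq)
  ultimately consider "y ! i = a" "y ! j = b" | "y ! i = b" "y ! j = a" by auto
  then show ?thesis
  proof cases
    case 1
    then show ?thesis using that ij by metis
  next
    case 2
    then have "y = x[j := a, i := b]" using ij(3,6) by (metis list_update_swap)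
    then show ?thesis using that[of j i] ij by blast
  qed
qed

text \<open>With \<open>y\<close> and \<open>z\<close> coded by ordered pairs \<open>(i, j)\<close>
  and \<open>(k, l)\<close>, a common neighbour requires \<open>i = k\<close> or
  \<open>j = l\<close> and is then \<open>x[i := a]\<close> or \<open>x[j := b]\<close>, both
  adjacent to \<open>x\<close>. The two equalities together would give \<open>y = z\<close>, so
  there is at most one.\<close>

lemma nbhd_overlap_two_two:
  assumes S: "finite S" "card S = m + 2"
    and w: "x \<in> words S m" "y \<in> words S m" "z \<in> words S m"
    and n: "\<not> near x y" "\<not> near x z" "\<not> near y z"
    and c: "card (nbhd S x \<inter> nbhd S y) = 2" "card (nbhd S x \<inter> nbhd S z) = 2"
  shows "nbhd S y \<inter> nbhd S z \<subseteq> nbhd S x" "card (nbhd S y \<inter> nbhd S z) \<le> 1"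
proof -
  obtain a b where ab: "S - set x = {a, b}" "a \<noteq> b"
    using card_unused[OF w(1) S] by (metis card_2_iff)
  have l: "length x = m" using w(1) by (simp add: words_def)
  have nab: "a \<notin> set x" "b \<notin> set x" "a \<in> S - set x" "b \<in> S - set x" using ab by auto
  have xa: "x ! t \<noteq> a" "x ! t \<noteq> b" if "t < m" for t using that l nab(1,2) nth_mem by metis+
  obtain i j where ij: "i < m" "j < m" "i \<noteq> j" "y = x[i := a, j := b]"
    using nbhd_overlap_two[OF w(1,2) n(1) c(1) ab] by metis
  obtain k l where kl: "k < m" "l < m" "k \<noteq> l" "z = x[k := a, l := b]"
    using nbhd_overlap_two[OF w(1,3) n(2) c(2) ab] by metis
  have yt: "y ! t = (if t = i then a else if t = j then b else x ! t)" if "t < m" for t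
    using ij that \<open>length x = m\<close> by (auto simp: nth_update_if)
  have zt: "z ! t = (if t = k then a else if t = l then b else x ! t)" if "t < m" for t
    using kl that \<open>length x = m\<close> by (auto simp: nth_update_if)
  have ne: "\<not> (i = k \<and> j = l)" using n(3) ij kl by auto
  have key: "(i = k \<and> q = x[i := a]) \<or> (j = l \<and> q = x[j := b])" if q: "q \<in> nbhd S y \<inter> nbhd S z" for q
  proof -
    obtain p r where pr: "p < m" "r < m" "p \<noteq> r" "y ! p \<noteq> z ! p" "y ! r \<noteq> z ! r"
      "z = y[p := z ! p, r := z ! r]" "q = y[p := z ! p]"
      using nbhd_overlap_far[OF w(2,3) n(3) q] by metis
    have only: "t = p \<or> t = r" if "t < m" "y ! t \<noteq> z ! t" for t
      using that pr(6) by (metis nth_list_update_neq)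
    have ly: "length y = m" using w(2) by (simp add: words_def)
    have qw: "q \<in> words S m" using q nbhd_subset_words[OF w(2)] by auto
    have qd: "q ! t \<noteq> q ! t'" if "t < m" "t' < m" "t \<noteq> t'" for t t'
      using qw that by (auto simp: words_def nth_eq_iff_index_eq)
    have qt: "q ! t = (if t = p then z ! p else y ! t)" if "t < m" for t
      using pr(7) that ly by (auto simp: nth_update_if)
    have qeq: "q = x[s := c]" if "\<And>t. t < m \<Longrightarrow> q ! t = (if t = s then c else x ! t)" for s c
      using that qw l by (intro nth_equalityI) (auto simp: words_def nth_update_if \<open>length x = m\<close>)
    consider "i = k" "j \<noteq> l" | "j = l" "i \<noteq> k" | "i \<noteq> k" "j \<noteq> l" using ne by auto
    then show ?thesis
    proof cases
      case 1
      have "j = p \<or> j = r" using only[of j] yt[of j] zt[of j] ij kl 1 xa[of j] by auto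
      moreover have "l = p \<or> l = r" using only[of l] yt[of l] zt[of l] ij kl 1 xa[of l] by auto
      ultimately have "p = j \<or> p = l" using 1 pr(3) by auto
      then show ?thesis
      proof
        assume "p = j"
        then have "q ! t = (if t = i then a else x ! t)" if "t < m" for t
          using that qt[of t] zt[of j] yt[of t] ij(3) kl(3) 1 by auto
        then have "q = x[i := a]" by (rule qeq)
        then show ?thesis using 1 by simp
      next
        \<comment> \<open>The midpoint that changes \<open>l\<close> first would contain
          \<open>b\<close> twice.\<close>
        assume "p = l"
        then have "q ! j = b" "q ! l = b" using qt[of j] qt[of l] zt[of l] yt[of j] ij kl 1 by auto
        then show ?thesis using qd[of j l] 1 ij kl by auto
      qed
    next
      case 2
      have "i = p \<or> i = r" using only[of i] yt[of i] zt[of i] ij kl 2 xa[of i] ab by auto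
      moreover have "k = p \<or> k = r" using only[of k] yt[of k] zt[of k] ij kl 2 xa[of k] ab by auto
      ultimately have "p = i \<or> p = k" using 2 pr(3) by auto
      then show ?thesis
      proof
        assume "p = i"
        then have "q ! t = (if t = j then b else x ! t)" if "t < m" for t
          using that qt[of t] zt[of i] yt[of t] ij(3) kl(3) 2 by auto
        then have "q = x[j := b]" by (rule qeq)
        then show ?thesis using 2 by simp
      next
        assume "p = k"
        then have "q ! i = a" "q ! k = a" using qt[of i] qt[of k] zt[of k] yt[of i] ij kl 2 by auto
        then show ?thesis using qd[of i k] 2 ij kl by auto
      qed
    next
      case 3
      have i: "i = p \<or> i = r" using only[of i] yt[of i] zt[of i] ij kl 3 xa[of i] ab by auto
      have k: "k = p \<or> k = r" using only[of k] yt[of k] zt[of k] ij kl 3 xa[of k] ab by auto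
      have j: "j = p \<or> j = r" using only[of j] yt[of j] zt[of j] ij kl 3 xa[of j] ab by auto
      have ll: "l = p \<or> l = r" using only[of l] yt[of l] zt[of l] ij kl 3 xa[of l] ab by auto
      \<comment> \<open>Only two positions may differ, so the two codes are reverses of each other
        and either midpoint would repeat a symbol.\<close>
      have "j = k" "l = i" using i j k ll 3 ij kl by auto
      moreover have "p = i \<or> p = j" using i j ij by auto
      ultimately have "q ! i = q ! j"
        using qt[of i] qt[of j] yt[of i] yt[of j] zt[of i] zt[of j] ij by auto
      then show ?thesis using qd[of i j] ij by auto
    qed
  qed
  have "x[i := a] \<in> nbhd S x" "x[j := b] \<in> nbhd S x"
    using update_in_words[OF w(1)] nab mem_nbhd[OF w(1)] by auto
  then show "nbhd S y \<inter> nbhd S z \<subseteq> nbhd S x" using key by blast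
  have "nbhd S y \<inter> nbhd S z \<subseteq> {if i = k then x[i := a] else x[j := b]}" using key ne by auto
  then have "card (nbhd S y \<inter> nbhd S z) \<le> card {if i = k then x[i := a] else x[j := b]}"
    by (intro card_mono) auto
  then show "card (nbhd S y \<inter> nbhd S z) \<le> 1" by simp
qed

section \<open>Unions of two, three and four closed neighbourhoods\<close>

lemma card_nbhd_Un2:
  assumes S: "finite S" "card S = m + 2" and "x \<in> words S m" "y \<in> words S m" "\<not> near x y"
  shows "card (nbhd S x \<union> nbhd S y) \<ge> 4 * m"
  using card_Un_Int[of "nbhd S x" "nbhd S y"] card_nbhd_overlap_far[OF assms(3-5)]
    card_nbhd[OF _ S] assms by auto

text \<open>Adjacent words share three words instead of two, which costs one. This serves
  exceptional words that may carry the same label.\<close>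

lemma card_nbhd_Un2_neq:
  assumes S: "finite S" "card S = m + 2" and "x \<in> words S m" "y \<in> words S m" "x \<noteq> y"
  shows "card (nbhd S x \<union> nbhd S y) \<ge> 4 * m - 1"
proof (cases "near x y")
  case True
  then have "y \<in> nbhd S x" using mem_nbhd[OF assms(3)] assms(4) by auto
  then obtain i a where "i < m" "a \<in> S - set x" "y = x[i := a]"
    using nbhd_eq[OF assms(3)] assms(5) by auto
  then have "card (nbhd S x \<inter> nbhd S y) = 3" using nbhd_overlap_adjacent(2)[OF assms(3) S] by auto
  then show ?thesis using card_Un_Int[of "nbhd S x" "nbhd S y"] card_nbhd[OF _ S] assms by auto
next
  case False
  then show ?thesis using card_nbhd_Un2[OF assms(1-4)] by simp
qed

lemma card_Un3_ge:
  assumes "finite A" "finite B" "finite C"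
  shows "card (A \<union> B \<union> C) + card (A \<inter> B) + card (A \<inter> C) + card (B \<inter> C) \<ge> card A + card B + card C"
proof -
  have "card ((A \<union> B) \<inter> C) \<le> card (A \<inter> C) + card (B \<inter> C)"
    by (metis Int_Un_distrib2 card_Un_le)
  then show ?thesis using card_Un_Int[of A B] card_Un_Int[of "A \<union> B" C] assms by auto
qed

text \<open>The target is \<open>3 * (2 * m + 1) - 4\<close>. The overlaps sum to more than 4 only
  if two of them have size 2; these two involve a common word, whose neighbourhood contains the
  third overlap, so that the latter costs nothing more.\<close>

lemma card_nbhd_Un3:
  assumes S: "finite S" "card S = m + 2"
    and w: "x \<in> words S m" "y \<in> words S m" "z \<in> words S m"
    and n: "\<not> near x y" "\<not> near x z" "\<not> near y z"
  shows "card (nbhd S x \<union> nbhd S y \<union> nbhd S z) \<ge> 6 * m - 1"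
proof -
  have *: "card (nbhd S x \<union> nbhd S y \<union> nbhd S z) \<ge> 6 * m - 1"
    if w: "x \<in> words S m" "y \<in> words S m" "z \<in> words S m"
    and n: "\<not> near x y" "\<not> near x z" "\<not> near y z"
    and c: "card (nbhd S x \<inter> nbhd S y) = 2" "card (nbhd S x \<inter> nbhd S z) = 2" for x y z
  proof -
    have "(nbhd S x \<union> nbhd S y) \<inter> nbhd S z = nbhd S x \<inter> nbhd S z"
      using nbhd_overlap_two_two(1)[OF S w n c] by auto
    then show ?thesis
      using card_Un_Int[of "nbhd S x" "nbhd S y"] card_Un_Int[of "nbhd S x \<union> nbhd S y" "nbhd S z"]
        c S(1) card_nbhd[OF _ S] w by auto
  qed
  have l: "card (nbhd S x \<inter> nbhd S y) \<le> 2" "card (nbhd S x \<inter> nbhd S z) \<le> 2" "card (nbhd S y \<inter> nbhd S z) \<le> 2"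
    using card_nbhd_overlap_far w n by blast+
  have n': "\<not> near y x" "\<not> near z x" "\<not> near z y" using n near_sym by blast+
  have s: "nbhd S y \<inter> nbhd S x = nbhd S x \<inter> nbhd S y" "nbhd S z \<inter> nbhd S x = nbhd S x \<inter> nbhd S z"
    "nbhd S z \<inter> nbhd S y = nbhd S y \<inter> nbhd S z" by auto
  consider "card (nbhd S x \<inter> nbhd S y) = 2" "card (nbhd S x \<inter> nbhd S z) = 2"
    | "card (nbhd S x \<inter> nbhd S y) = 2" "card (nbhd S y \<inter> nbhd S z) = 2"
    | "card (nbhd S x \<inter> nbhd S z) = 2" "card (nbhd S y \<inter> nbhd S z) = 2"
    | "card (nbhd S x \<inter> nbhd S y) + card (nbhd S x \<inter> nbhd S z) + card (nbhd S y \<inter> nbhd S z) \<le> 4"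
    using l by linarith
  then show ?thesis
  proof cases
    case 1
    show ?thesis using *[OF w n] 1 by simp
  next
    case 2
    show ?thesis using *[OF w(2,1,3) n'(1) n(3) n(2)] 2 s by (simp add: Un_ac)
  next
    case 3
    show ?thesis using *[OF w(3,1,2) n'(2,3) n(1)] 3 s by (simp add: Un_ac)
  next
    case 4
    then show ?thesis using card_Un3_ge[of "nbhd S x" "nbhd S y" "nbhd S z"] S(1) card_nbhd[OF _ S] w
      by auto
  qed
qed

text \<open>Adds \<open>t\<close> to a triple with two overlaps of size 2 at \<open>x\<close>. The
  triple has at least \<open>6 * m - 1\<close> words, so it suffices that it covers at most 4 of the
  \<open>2 * m + 1\<close> words around \<open>t\<close>.\<close>

lemma card_nbhd_Un4_aux:
  assumes S: "finite S" "card S = m + 2"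
    and w: "x \<in> words S m" "y \<in> words S m" "z \<in> words S m" "t \<in> words S m"
    and n: "\<not> near x y" "\<not> near x z" "\<not> near y z" "\<not> near x t" "\<not> near y t" "\<not> near z t"
    and c: "card (nbhd S x \<inter> nbhd S y) = 2" "card (nbhd S x \<inter> nbhd S z) = 2"
  shows "card (nbhd S x \<union> nbhd S y \<union> nbhd S z \<union> nbhd S t) \<ge> 8 * m - 4"
proof -
  let ?X = "nbhd S x" and ?Y = "nbhd S y" and ?Z = "nbhd S z" and ?T = "nbhd S t"
  have n': "\<not> near y x" "\<not> near z x" "\<not> near z y" "\<not> near t x" "\<not> near t y" "\<not> near t z"
    using n near_sym by blast+
  have l: "card (?X \<inter> ?T) \<le> 2" "card (?Y \<inter> ?T) \<le> 2" "card (?Z \<inter> ?T) \<le> 2"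
    using card_nbhd_overlap_far w n by blast+
  have 3: "card (?X \<union> ?Y \<union> ?Z) \<ge> 6 * m - 1" by (rule card_nbhd_Un3[OF S w(1-3) n(1-3)])
  have "card ((?X \<union> ?Y \<union> ?Z) \<inter> ?T) \<le> 4"
  proof -
    have e: "(?X \<union> ?Y \<union> ?Z) \<inter> ?T = (?X \<inter> ?T) \<union> (?Y \<inter> ?T) \<union> (?Z \<inter> ?T)" by auto
    have le: "card ((?X \<union> ?Y \<union> ?Z) \<inter> ?T) \<le> card (?X \<inter> ?T) + card (?Y \<inter> ?T) + card (?Z \<inter> ?T)"
      unfolding e using card_Un_le[of "?X \<inter> ?T \<union> ?Y \<inter> ?T" "?Z \<inter> ?T"] card_Un_le[of "?X \<inter> ?T" "?Y \<inter> ?T"] by linarith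
    have xt: "card (?X \<inter> ?T) \<le> 1" if "card (?Y \<inter> ?T) = 2 \<or> card (?Z \<inter> ?T) = 2"
      using that nbhd_overlap_two_two(2)[OF S w(2,1,4) n'(1) n(5) n(4)]
        nbhd_overlap_two_two(2)[OF S w(3,1,4) n'(2) n(6) n(4)] c by (auto simp: Int_commute)
    show ?thesis
    \<comment> \<open>If \<open>?Y\<close> and \<open>?Z\<close> both meet \<open>?T\<close> in two
      words, \<open>?X\<close> contributes nothing new. If just one does, the other and
      \<open>?X\<close> contribute at most one each. If neither does, the bounds are 1, 1 and
      2.\<close>
    proof (cases "card (?Y \<inter> ?T) = 2 \<and> card (?Z \<inter> ?T) = 2")
      case True
      then have "?X \<inter> ?T \<subseteq> ?Y"
        using nbhd_overlap_two_two(1)[OF S w(2,1,4) n'(1) n(5) n(4)] c by (auto simp: Int_commute)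
      then have "(?X \<union> ?Y \<union> ?Z) \<inter> ?T = (?Y \<inter> ?T) \<union> (?Z \<inter> ?T)" by auto
      then show ?thesis using card_Un_le[of "?Y \<inter> ?T" "?Z \<inter> ?T"] l by simp
    next
      case False
      then show ?thesis using le l xt by linarith
    qed
  qed
  then show ?thesis using 3 card_Un_Int[of "?X \<union> ?Y \<union> ?Z" ?T] S(1) card_nbhd[OF w(4) S] by auto
qed

text \<open>The six numbers sit on the edges of a complete graph on four vertices, and two edges
  with a common end are not both 2. The edges of value 2 form a matching, hence number at most two,
  and the other four are at most 1.\<close>

lemma adjacent_pairs_sum_le_8:
  fixes a b c d e f :: nat
  assumes "a \<le> 2" "b \<le> 2" "c \<le> 2" "d \<le> 2" "e \<le> 2" "f \<le> 2"
    and "\<not> (a = 2 \<and> b = 2)" "\<not> (a = 2 \<and> c = 2)" "\<not> (a = 2 \<and> d = 2)" "\<not> (a = 2 \<and> e = 2)"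
    "\<not> (b = 2 \<and> c = 2)" "\<not> (b = 2 \<and> d = 2)" "\<not> (b = 2 \<and> f = 2)"
    "\<not> (c = 2 \<and> e = 2)" "\<not> (c = 2 \<and> f = 2)" "\<not> (d = 2 \<and> e = 2)" "\<not> (d = 2 \<and> f = 2)" "\<not> (e = 2 \<and> f = 2)"
  shows "a + b + c + d + e + f \<le> 8"
  using assms by (cases "a = 2"; cases "b = 2"; cases "c = 2"; cases "d = 2"; cases "e = 2"; cases "f = 2") auto

text \<open>The target is \<open>4 * (2 * m + 1) - 8\<close>. Either two overlaps of size 2 involve
  a common word, or the overlaps of size 2 form a matching and all six sum to at most 8.\<close>

lemma card_nbhd_Un4:
  assumes S: "finite S" "card S = m + 2"
    and w: "x \<in> words S m" "y \<in> words S m" "z \<in> words S m" "t \<in> words S m"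
    and n: "\<not> near x y" "\<not> near x z" "\<not> near y z" "\<not> near x t" "\<not> near y t" "\<not> near z t"
  shows "card (nbhd S x \<union> nbhd S y \<union> nbhd S z \<union> nbhd S t) \<ge> 8 * m - 4"
proof -
  let ?X = "nbhd S x" and ?Y = "nbhd S y" and ?Z = "nbhd S z" and ?T = "nbhd S t"
  have n': "\<not> near y x" "\<not> near z x" "\<not> near z y" "\<not> near t x" "\<not> near t y" "\<not> near t z"
    using n near_sym by blast+
  have l: "card (?X \<inter> ?Y) \<le> 2" "card (?X \<inter> ?Z) \<le> 2" "card (?Y \<inter> ?Z) \<le> 2"
    "card (?X \<inter> ?T) \<le> 2" "card (?Y \<inter> ?T) \<le> 2" "card (?Z \<inter> ?T) \<le> 2"
    using card_nbhd_overlap_far w n by blast+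
  note A = card_nbhd_Un4_aux[OF S]
  show ?thesis
  proof (rule ccontr)
    assume neg: "\<not> ?thesis"
    have c1: "\<not> (card (?X \<inter> ?Y) = 2 \<and> card (?X \<inter> ?Z) = 2)"
      using A[of x y z t] w n n' neg by (auto simp: Un_ac Int_commute)
    have c2: "\<not> (card (?X \<inter> ?Y) = 2 \<and> card (?X \<inter> ?T) = 2)"
      using A[of x y t z] w n n' neg by (auto simp: Un_ac Int_commute)
    have c3: "\<not> (card (?X \<inter> ?Z) = 2 \<and> card (?X \<inter> ?T) = 2)"
      using A[of x z t y] w n n' neg by (auto simp: Un_ac Int_commute)
    have c4: "\<not> (card (?X \<inter> ?Y) = 2 \<and> card (?Y \<inter> ?Z) = 2)"
      using A[of y x z t] w n n' neg by (auto simp: Un_ac Int_commute)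
    have c5: "\<not> (card (?X \<inter> ?Y) = 2 \<and> card (?Y \<inter> ?T) = 2)"
      using A[of y x t z] w n n' neg by (auto simp: Un_ac Int_commute)
    have c6: "\<not> (card (?Y \<inter> ?Z) = 2 \<and> card (?Y \<inter> ?T) = 2)"
      using A[of y z t x] w n n' neg by (auto simp: Un_ac Int_commute)
    have c7: "\<not> (card (?X \<inter> ?Z) = 2 \<and> card (?Y \<inter> ?Z) = 2)"
      using A[of z x y t] w n n' neg by (auto simp: Un_ac Int_commute)
    have c8: "\<not> (card (?X \<inter> ?Z) = 2 \<and> card (?Z \<inter> ?T) = 2)"
      using A[of z x t y] w n n' neg by (auto simp: Un_ac Int_commute)
    have c9: "\<not> (card (?Y \<inter> ?Z) = 2 \<and> card (?Z \<inter> ?T) = 2)"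
      using A[of z y t x] w n n' neg by (auto simp: Un_ac Int_commute)
    have c10: "\<not> (card (?X \<inter> ?T) = 2 \<and> card (?Y \<inter> ?T) = 2)"
      using A[of t x y z] w n n' neg by (auto simp: Un_ac Int_commute)
    have c11: "\<not> (card (?X \<inter> ?T) = 2 \<and> card (?Z \<inter> ?T) = 2)"
      using A[of t x z y] w n n' neg by (auto simp: Un_ac Int_commute)
    have c12: "\<not> (card (?Y \<inter> ?T) = 2 \<and> card (?Z \<inter> ?T) = 2)"
      using A[of t y z x] w n n' neg by (auto simp: Un_ac Int_commute)
    have "card (?X \<inter> ?Y) + card (?X \<inter> ?Z) + card (?Y \<inter> ?Z)
      + card (?X \<inter> ?T) + card (?Y \<inter> ?T) + card (?Z \<inter> ?T) \<le> 8"
      using c1 c2 c3 c4 c5 c6 c7 c8 c9 c10 c11 c12 l by (intro adjacent_pairs_sum_le_8) blast+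
    moreover have "card ((?X \<union> ?Y \<union> ?Z) \<inter> ?T) \<le> card (?X \<inter> ?T) + card (?Y \<inter> ?T) + card (?Z \<inter> ?T)"
    proof -
      have e: "(?X \<union> ?Y \<union> ?Z) \<inter> ?T = (?X \<inter> ?T) \<union> (?Y \<inter> ?T) \<union> (?Z \<inter> ?T)" by auto
      show ?thesis unfolding e
        using card_Un_le[of "?X \<inter> ?T \<union> ?Y \<inter> ?T" "?Z \<inter> ?T"] card_Un_le[of "?X \<inter> ?T" "?Y \<inter> ?T"] by linarith
    qed
    ultimately show False using neg card_Un3_ge[of ?X ?Y ?Z] card_Un_Int[of "?X \<union> ?Y \<union> ?Z" ?T]
      S(1) card_nbhd[OF _ S] w by auto
  qed
qed

lemma card_ge_2D:
  assumes "card X \<ge> 2"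
  obtains a b where "a \<in> X" "b \<in> X" "a \<noteq> b"
proof -
  obtain T where "T \<subseteq> X" "card T = 2" using obtain_subset_with_card_n[OF assms] by metis
  then show ?thesis using that by (auto simp: card_2_iff)
qed

lemma card_ge_3D:
  assumes "card X \<ge> 3"
  obtains a b c where "a \<in> X" "b \<in> X" "c \<in> X" "a \<noteq> b" "a \<noteq> c" "b \<noteq> c"
proof -
  obtain T where "T \<subseteq> X" "card T = 3" using obtain_subset_with_card_n[OF assms] by metis
  then show ?thesis using that by (auto simp: card_3_iff)
qed

lemma card_ge_4D:
  assumes "card X \<ge> 4"
  obtains a b c d where "a \<in> X" "b \<in> X" "c \<in> X" "d \<in> X"
    "a \<noteq> b" "a \<noteq> c" "b \<noteq> c" "a \<noteq> d" "b \<noteq> d" "c \<noteq> d"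
proof -
  have "X \<noteq> {}" using assms by auto
  then obtain d where d: "d \<in> X" by blast
  then have "card (X - {d}) \<ge> 3" using assms by simp
  then obtain a b c where "a \<in> X - {d}" "b \<in> X - {d}" "c \<in> X - {d}" "a \<noteq> b" "a \<noteq> c" "b \<noteq> c"
    using card_ge_3D by metis
  then show ?thesis using that[of a b c d] d by auto
qed

section \<open>Labellings of one layer\<close>

definition slice :: "'a list set \<Rightarrow> 'a \<Rightarrow> 'a list set" where
  "slice F s = {u. s # u \<in> F}"

lemma Cons_in_words [simp]: "s # u \<in> words S (Suc k) \<longleftrightarrow> s \<in> S \<and> u \<in> words (S - {s}) k"
  by (auto simp: words_def)

lemma in_words_SucE:
  assumes "w \<in> words S (Suc k)"
  obtains s u where "w = s # u" "s \<in> S" "u \<in> words (S - {s}) k"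
  using assms by (cases w) (auto simp: words_def)

text \<open>Fixing the first symbol removes it from the alphabet, so length and alphabet shrink
  together and the relation \<open>card S = m + 2\<close> persists in each slice.\<close>

lemma labelling_slice:
  assumes "labelling S (Suc k) F f" "s \<in> S"
  shows "labelling (S - {s}) k (slice F s) (\<lambda>u. f (s # u))"
  using assms unfolding labelling_def slice_def by auto

lemma labellingD: "labelling S m F f \<Longrightarrow> w \<in> words S m - F \<Longrightarrow> z \<in> words S m - F \<Longrightarrow> near w z \<Longrightarrow> f w = f z"
  unfolding labelling_def by blast

lemma slice_subset_words: "F \<subseteq> words S (Suc k) \<Longrightarrow> slice F s \<subseteq> words (S - {s}) k"
  by (auto simp: slice_def)

lemma card_eq_sum_slice:
  assumes "finite S" "F \<subseteq> words S (Suc k)"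
  shows "card F = (\<Sum>s\<in>S. card (slice F s))"
proof -
  have F: "F = (\<Union>s\<in>S. (#) s ` slice F s)"
  proof (intro subset_antisym subsetI)
    fix w assume w: "w \<in> F"
    then have "w \<in> words S (Suc k)" using assms(2) by auto
    then obtain s u where "w = s # u" "s \<in> S" by (rule in_words_SucE)
    then show "w \<in> (\<Union>s\<in>S. (#) s ` slice F s)" using w by (auto simp: slice_def)
  qed (auto simp: slice_def)
  have fin: "finite (slice F s)" for s
    by (rule finite_subset[OF slice_subset_words[OF assms(2)]]) (use assms in simp)
  have "card (\<Union>s\<in>S. (#) s ` slice F s) = (\<Sum>s\<in>S. card ((#) s ` slice F s))"
    by (rule card_UN_disjoint) (use assms fin in auto)
  then have "card F = (\<Sum>s\<in>S. card ((#) s ` slice F s))" using F by simp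
  also have "\<dots> = (\<Sum>s\<in>S. card (slice F s))" by (intro sum.cong) (auto intro!: card_image)
  finally show ?thesis .
qed

lemma card_slices_le:
  assumes "finite S" "F \<subseteq> words S (Suc k)" "T \<subseteq> S"
  shows "(\<Sum>s\<in>T. card (slice F s)) \<le> card F"
  unfolding card_eq_sum_slice[OF assms(1,2)] by (rule sum_mono2) (use assms in auto)

lemma card_words:
  assumes "finite T" "k \<le> card T"
  shows "card (words T k) = \<Prod>{card T - k + 1..card T}"
  using card_lists_distinct_length_eq[OF assms] by (simp add: words_def)

lemma card_words_Suc:
  assumes "finite T" "card T = k + 1"
  shows "card (words T k) = fact (k + 1)"
proof -
  have "\<Prod>{1..k + 1} = \<Prod>{2..k + 1}"
    using prod.atLeast_Suc_atMost[of 1 "k + 1" "\<lambda>i. i"] by (simp add: numeral_2_eq_2)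
  then show ?thesis using card_words[of T k] assms by (simp add: fact_prod numeral_2_eq_2)
qed

text \<open>Slices \<open>s\<close> and \<open>t\<close> are joined by the edges from
  \<open>s # u\<close> to \<open>t # u\<close> where \<open>u\<close> avoids both symbols. There are
  \<open>fact (k + 1)\<close> of them, and each fault destroys at most one.\<close>

lemma common_tail_exists:
  assumes "finite S" "card S = k + 3" "s \<in> S" "t \<in> S" "s \<noteq> t" "finite A" "finite B"
    "card A + card B < fact (k + 1)"
  obtains u where "u \<in> words (S - {s}) k - A" "u \<in> words (S - {t}) k - B"
proof -
  have "card (words (S - {s} - {t}) k) = fact (k + 1)"
    by (rule card_words_Suc) (use assms in auto)
  moreover have "card (A \<union> B) < fact (k + 1)" using card_Un_le[of A B] assms(8) by simp
  ultimately have "\<not> words (S - {s} - {t}) k \<subseteq> A \<union> B"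
    using assms(6,7) by (metis card_mono finite_UnI linorder_not_less)
  then obtain u where "u \<in> words (S - {s} - {t}) k" "u \<notin> A" "u \<notin> B" by blast
  then show ?thesis using that by (auto simp: words_def)
qed

text \<open>Each slice with fewer than \<open>2 * k\<close> faults is compared with a least faulty
  slice \<open>r\<close>, to which some edge survives by counting. The two alternatives for
  \<open>card F\<close> belong to the connectivity lemma and to the structure lemma that
  follow.\<close>

lemma good_slices_same_label:
  assumes S: "finite S" "card S = k + 3" and F: "F \<subseteq> words S (Suc k)" and f: "labelling S (Suc k) F f"
    and k: "k \<ge> 1" and bd: "card F \<le> 2 * k + 1 \<or> k \<ge> 2 \<and> card F \<le> 4 * k + 2"
    and const: "\<And>s u v. s \<in> S \<Longrightarrow> card (slice F s) < 2 * k \<Longrightarrow> u \<in> words (S - {s}) k - slice F s \<Longrightarrow>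
      v \<in> words (S - {s}) k - slice F s \<Longrightarrow> f (s # u) = f (s # v)"
  shows "\<exists>c. \<forall>s\<in>S. card (slice F s) < 2 * k \<longrightarrow> (\<forall>u\<in>words (S - {s}) k - slice F s. f (s # u) = c)"
proof -
  define g where "g s = card (slice F s)" for s
  have fin: "finite (slice F s)" for s
    by (rule finite_subset[OF slice_subset_words[OF F]]) (use S in simp)
  have "S \<noteq> {}" using S by auto
  then have "Min (g ` S) \<in> g ` S" using S by simp
  then obtain r where r: "r \<in> S" "Min (g ` S) = g r" by auto
  have rmin: "g r \<le> g s" if "s \<in> S" for s
    unfolding r(2)[symmetric] by (rule Min_le) (use that S in auto)
  have "(k + 3) * g r = (\<Sum>s\<in>S. g r)" using S by simp
  also have "\<dots> \<le> (\<Sum>s\<in>S. g s)" by (rule sum_mono) (use rmin in auto)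
  also have "\<dots> = card F" using card_eq_sum_slice[OF S(1) F] by (simp add: g_def)
  finally have gr: "(k + 3) * g r \<le> card F" .
  \<comment> \<open>Averaging over the \<open>k + 3\<close> slices. The small cases need the sharper
    values, as \<open>0 + 1 < fact 2\<close> and \<open>2 + 3 < fact 3\<close> hold with nothing to
    spare.\<close>
  have gr3: "g r \<le> 3 \<and> (k = 1 \<longrightarrow> g r = 0) \<and> (k = 2 \<longrightarrow> g r \<le> 2)"
  proof -
    have "k = 1 \<Longrightarrow> g r = 0" using gr bd by auto
    moreover have "k = 2 \<Longrightarrow> g r \<le> 2" using gr bd by auto
    moreover have "g r \<le> 3"
    proof (rule ccontr)
      assume "\<not> g r \<le> 3"
      then have "(k + 3) * 4 \<le> (k + 3) * g r" by (intro mult_left_mono) auto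
      then show False using gr bd by auto
    qed
    ultimately show ?thesis by blast
  qed
  have fk: "g r + g s < fact (k + 1) \<and> g r < 2 * k" if "g s < 2 * k" for s
  proof -
    consider "k = 1" | "k = 2" | "k \<ge> 3" using k by linarith
    then show ?thesis
    proof cases
      case 3
      then have "fact k \<ge> (fact 3 :: nat)" by (intro fact_mono) auto
      then have "fact k \<ge> (6 :: nat)" by (simp add: numeral_eq_Suc)
      then have "(k + 1) * fact k \<ge> (k + 1) * (6 :: nat)" by (intro mult_left_mono) auto
      then show ?thesis using that gr3 3 by simp
    qed (use that gr3 in \<open>auto simp: numeral_eq_Suc\<close>)
  qed
  \<comment> \<open>A reference word of slice \<open>r\<close>; it is meaningful as soon as some
    word of this slice survives, which every use of \<open>cr\<close> provides.\<close>
  define u0 where "u0 = (SOME u. u \<in> words (S - {r}) k - slice F r)"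
  have cr: "f (r # u) = f (r # u0)" if u: "u \<in> words (S - {r}) k - slice F r" and "g s < 2 * k" for u s
  proof -
    have "u0 \<in> words (S - {r}) k - slice F r" unfolding u0_def by (rule someI, rule u)
    then show ?thesis using const[OF r(1) _ u] fk that by (auto simp: g_def)
  qed
  show ?thesis
  proof (intro exI[of _ "f (r # u0)"] ballI impI)
    fix s u assume s: "s \<in> S" "card (slice F s) < 2 * k" and u: "u \<in> words (S - {s}) k - slice F s"
    then have gs: "g s < 2 * k" by (simp add: g_def)
    show "f (s # u) = f (r # u0)"
    proof (cases "s = r")
      case True
      then show ?thesis using cr u gs by blast
    next
      case False
      have "card (slice F s) + card (slice F r) < fact (k + 1)" using fk[OF gs] by (simp add: g_def add.commute)
      then obtain v where v: "v \<in> words (S - {s}) k - slice F s" "v \<in> words (S - {r}) k - slice F r"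
        by (rule common_tail_exists[OF S s(1) r(1) False fin[of s] fin[of r]])
      have "f (s # v) = f (r # v)"
        by (rule labellingD[OF f]) (use v s r in \<open>auto simp: slice_def\<close>)
      then show ?thesis using const[OF s u v(1)] cr[OF v(2) gs] by simp
    qed
  qed
qed

text \<open>One layer stays connected after fewer than \<open>2 * m\<close> faults. A survivor in a
  slice with at least \<open>2 * k\<close> faults has two neighbours in other slices. The total of
  at most \<open>2 * k + 1\<close> faults cannot include both, and it leaves the other slices
  sparsely faulty, hence with the common label.\<close>

lemma labelling_constant:
  assumes "finite S" "card S = m + 2" "F \<subseteq> words S m" "labelling S m F f" "card F < 2 * m"
    and "x \<in> words S m - F" "y \<in> words S m - F"
  shows "f x = f y"
  using assms
proof (induction m arbitrary: S F f x y)
  case (Suc k)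
  note S = Suc.prems(1,2) and F = Suc.prems(3) and f = Suc.prems(4) and cF = Suc.prems(5)
  have finF: "finite F" by (rule finite_subset[OF F]) (use S in simp)
  show ?case
  proof (cases "k = 0")
    case True
    then have "near x y" using Suc.prems(6,7) by (auto simp: words_def near_def)
    then show ?thesis using labellingD[OF f] Suc.prems by blast
  next
    case False
    have "\<exists>c. \<forall>s\<in>S. card (slice F s) < 2 * k \<longrightarrow> (\<forall>u\<in>words (S - {s}) k - slice F s. f (s # u) = c)"
    proof (rule good_slices_same_label[OF S(1) _ F f])
      fix s u v assume a: "s \<in> S" "card (slice F s) < 2 * k" "u \<in> words (S - {s}) k - slice F s"
        "v \<in> words (S - {s}) k - slice F s"
      show "f (s # u) = f (s # v)"
        by (rule Suc.IH[OF _ _ slice_subset_words[OF F] labelling_slice[OF f a(1)]]) (use a S in auto)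
    qed (use False S cF in auto)
    then obtain c where c: "\<And>s u. s \<in> S \<Longrightarrow> card (slice F s) < 2 * k \<Longrightarrow> u \<in> words (S - {s}) k - slice F s \<Longrightarrow> f (s # u) = c"
      by blast
    have "f w = c" if w: "w \<in> words S (Suc k) - F" for w
    proof -
      obtain s u where su: "w = s # u" "s \<in> S" "u \<in> words (S - {s}) k" using w by (auto elim: in_words_SucE)
      show ?thesis
      proof (cases "card (slice F s) < 2 * k")
        case True
        then show ?thesis using c su w by (auto simp: slice_def)
      next
        case bad: False
        obtain a b where ab: "S - set w = {a, b}" "a \<noteq> b"
          using card_unused[of w S "Suc k"] w S by (auto simp: card_2_iff)
        have mem: "a \<in> S" "b \<in> S" "a \<noteq> s" "b \<noteq> s" "a \<notin> set u" "b \<notin> set u" using ab su by auto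
        have ws: "t # u \<in> words S (Suc k)" if "t \<in> {a, b}" for t
          using that mem su(3) by (auto simp: words_def)
        have sum: "card (slice F s) + card (slice F a) + card (slice F b) \<le> card F"
          using card_slices_le[OF S(1) F, of "{s, a, b}"] mem ab su(2) by simp
        have fin: "finite (slice F t)" for t
          by (rule finite_subset[OF slice_subset_words[OF F]]) (use S in simp)
        have "\<not> (a # u \<in> F \<and> b # u \<in> F)"
        proof
          assume "a # u \<in> F \<and> b # u \<in> F"
          then have "card (slice F a) > 0" "card (slice F b) > 0"
            using fin by (auto simp: card_gt_0_iff slice_def)
          then show False using sum bad cF by auto
        qed
        then obtain t where t: "t \<in> {a, b}" "t # u \<notin> F" by blast
        have "card (slice F t) < 2 * k" using sum bad cF t(1) False by auto
        moreover have "u \<in> words (S - {t}) k - slice F t" using ws[OF t(1)] t(2) by (auto simp: slice_def)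
        ultimately have "f (t # u) = c" using c t mem by auto
        moreover have "f w = f (t # u)"
          by (rule labellingD[OF f w]) (use ws[OF t(1)] t su in auto)
        ultimately show ?thesis by simp
      qed
    qed
    then show ?thesis using Suc.prems(6,7) by simp
  qed
qed simp

text \<open>For counting labels through something that determines them: the tails of words, and
  later the reachability classes.\<close>

lemma card_image_factor_le:
  assumes "finite A" "\<And>x y. x \<in> A \<Longrightarrow> y \<in> A \<Longrightarrow> g x = g y \<Longrightarrow> f x = f y"
  shows "card (f ` A) \<le> card (g ` A)"
proof -
  have "f ` A \<subseteq> (\<lambda>b. f (inv_into A g b)) ` (g ` A)"
  proof
    fix c assume "c \<in> f ` A"
    then obtain x where x: "x \<in> A" "c = f x" by auto
    have "f (inv_into A g (g x)) = f x"
      using x(1) by (intro assms(2)) (auto simp: inv_into_into f_inv_into_f)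
    then show "c \<in> (\<lambda>b. f (inv_into A g b)) ` (g ` A)" using x by force
  qed
  then show ?thesis using assms(1) by (meson card_image_le card_mono finite_imageI le_trans)
qed

text \<open>At most two slices have \<open>2 * k\<close> faults or more, and all others carry the
  label \<open>c\<close>. The thresholds are the prices within a single crowded slice: two
  exceptional words cost \<open>4 * k + 1\<close> faults, two exceptional labels
  \<open>4 * k + 2\<close>, and three labels more.\<close>

lemma labelling_structure:
  assumes S: "finite S" "card S = k + 3" and F: "F \<subseteq> words S (Suc k)" and f: "labelling S (Suc k) F f"
    and k: "k \<ge> 2" and cF: "card F \<le> 4 * k + 2"
  obtains c where "card F \<le> 4 * k \<longrightarrow> card {w \<in> words S (Suc k) - F. f w \<noteq> c} \<le> 1"
    "card F \<le> 4 * k + 1 \<longrightarrow> card (f ` {w \<in> words S (Suc k) - F. f w \<noteq> c}) \<le> 1"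
    "card (f ` {w \<in> words S (Suc k) - F. f w \<noteq> c}) \<le> 2"
proof -
  have finF: "finite F" by (rule finite_subset[OF F]) (use S in simp)
  have fin: "finite (slice F t)" for t
    by (rule finite_subset[OF slice_subset_words[OF F]]) (use S in simp)
  have "\<exists>c. \<forall>s\<in>S. card (slice F s) < 2 * k \<longrightarrow> (\<forall>u\<in>words (S - {s}) k - slice F s. f (s # u) = c)"
  proof (rule good_slices_same_label[OF S F f])
    fix s u v assume a: "s \<in> S" "card (slice F s) < 2 * k" "u \<in> words (S - {s}) k - slice F s"
      "v \<in> words (S - {s}) k - slice F s"
    show "f (s # u) = f (s # v)"
      by (rule labelling_constant[OF _ _ slice_subset_words[OF F] labelling_slice[OF f a(1)]]) (use a S in auto)
  qed (use k S cF in auto)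
  then obtain c where c: "\<And>s u. s \<in> S \<Longrightarrow> card (slice F s) < 2 * k \<Longrightarrow> u \<in> words (S - {s}) k - slice F s \<Longrightarrow> f (s # u) = c"
    by blast
  define A where "A = {w \<in> words S (Suc k) - F. f w \<noteq> c}"
  define Bad where "Bad = {s \<in> S. card (slice F s) \<ge> 2 * k}"
  have finA: "finite A" using S by (simp add: A_def)
  have finB: "finite Bad" using S by (simp add: Bad_def)
  have Ahd: "s \<in> Bad" if "s # u \<in> A" for s u
    using that c[of s u] not_less[of "card (slice F s)" "2 * k"] by (auto simp: A_def Bad_def) (auto simp: slice_def)
  \<comment> \<open>If it survived, this neighbour in a sparsely faulty slice would have the label
    \<open>c\<close> and pass it on.\<close>
  have mate: "a # u \<in> F" if "s # u \<in> A" "a \<in> S - set (s # u)" "a \<notin> Bad" for s u a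
  proof (rule ccontr)
    assume nF: "a # u \<notin> F"
    have w: "a # u \<in> words S (Suc k)" using that by (auto simp: A_def words_def)
    then have "f (a # u) = c" using that(3) w nF by (intro c) (auto simp: Bad_def slice_def)
    moreover have "f (s # u) = f (a # u)" by (rule labellingD[OF f]) (use that w nF in \<open>auto simp: A_def\<close>)
    ultimately show False using that(1) by (simp add: A_def)
  qed
  have "2 * k * card Bad \<le> (\<Sum>s\<in>Bad. card (slice F s))"
    using sum_bounded_below[of Bad "2 * k" "\<lambda>s. card (slice F s)"] by (simp add: Bad_def mult.commute)
  also have "\<dots> \<le> card F" by (rule card_slices_le[OF S(1) F]) (auto simp: Bad_def)
  finally have Bad2: "2 * k * card Bad \<le> card F" .
  have "card Bad \<le> 2"
  proof (rule ccontr)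
    assume "\<not> card Bad \<le> 2"
    then have "2 * k * 3 \<le> 2 * k * card Bad" by (intro mult_left_mono) auto
    then have "2 * k * 3 \<le> 4 * k + 2" using Bad2 cF by linarith
    then show False using k by linarith
  qed
  then consider "Bad = {}" | s where "Bad = {s}" | s t where "Bad = {s, t}" "s \<noteq> t"
  proof -
    assume "card Bad \<le> 2"
    then have "card Bad = 0 \<or> card Bad = 1 \<or> card Bad = 2" by linarith
    then have "Bad = {} \<or> (\<exists>s. Bad = {s}) \<or> (\<exists>s t. Bad = {s, t} \<and> s \<noteq> t)"
      using finB by (auto simp: card_1_singleton_iff card_2_iff)
    then show thesis using that by blast
  qed
  then have "(card F \<le> 4 * k \<longrightarrow> card A \<le> 1) \<and> (card F \<le> 4 * k + 1 \<longrightarrow> card (f ` A) \<le> 1) \<and> card (f ` A) \<le> 2"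
  proof cases
    case 1
    have "A = {}"
    proof (rule ccontr)
      assume "A \<noteq> {}"
      then obtain w where w: "w \<in> A" by blast
      then obtain s u where "w = s # u" by (auto simp: A_def elim: in_words_SucE)
      then show False using Ahd w 1 by blast
    qed
    then show ?thesis by simp
  next
    case (2 s)
    then have s: "s \<in> S" by (auto simp: Bad_def)
    \<comment> \<open>The exceptional words share one slice. Each tail in \<open>U\<close> has two
      faulty neighbours outside it, collected in \<open>M\<close>, and the boundary
      \<open>NU - U\<close> is faulty inside it. Together these are at least
      \<open>card NU + card U\<close> faults.\<close>
    define U where "U = {u. s # u \<in> A}"
    have AU: "A = (#) s ` U"
    proof (intro subset_antisym subsetI)
      fix w assume w: "w \<in> A"
      then obtain t u where tu: "w = t # u" by (auto simp: A_def elim: in_words_SucE)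
      then have "t = s" using Ahd w 2 by blast
      then show "w \<in> (#) s ` U" using w tu by (auto simp: U_def)
    qed (auto simp: U_def)
    have cA: "card A = card U" unfolding AU by (rule card_image) auto
    have finU: "finite U" using finA unfolding AU by (rule finite_imageD) auto
    have Uw: "U \<subseteq> words (S - {s}) k" by (auto simp: U_def A_def)
    define NU where "NU = (\<Union>u\<in>U. nbhd (S - {s}) u)"
    define M where "M = (\<lambda>(u, a). a # u) ` (SIGMA u:U. S - {s} - set u)"
    have "inj_on (\<lambda>(u, a). a # u) (SIGMA u:U. S - {s} - set u)" by (auto simp: inj_on_def)
    then have "card M = (\<Sum>u\<in>U. card (S - {s} - set u))"
      unfolding M_def using finU S by (simp add: card_image)
    also have "\<dots> = (\<Sum>u\<in>U. 2)"
      by (rule sum.cong[OF refl], rule card_unused[of _ "S - {s}" k]) (use Uw S s in auto)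
    finally have cM: "card M = 2 * card U" by simp
    have MF: "M \<subseteq> F - (#) s ` slice F s"
    proof
      fix w assume "w \<in> M"
      then obtain u a where ua: "w = a # u" "u \<in> U" "a \<in> S - {s} - set u" by (auto simp: M_def)
      then have "a # u \<in> F" using mate[of s u a] 2 by (auto simp: U_def)
      then show "w \<in> F - (#) s ` slice F s" using ua by auto
    qed
    have sF: "(#) s ` slice F s \<subseteq> F" by (auto simp: slice_def)
    have "card ((#) s ` slice F s) = card (slice F s)" by (rule card_image) auto
    then have "card M + card (slice F s) \<le> card F"
      using card_mono[OF _ MF] card_Diff_subset[OF _ sF] card_mono[OF finF sF] finF fin by auto
    moreover have "NU - U \<subseteq> slice F s"
    proof
      fix z assume z: "z \<in> NU - U"
      then obtain u where u: "u \<in> U" "z \<in> nbhd (S - {s}) u" by (auto simp: NU_def)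
      have zw: "z \<in> words (S - {s}) k" "near u z" using u Uw mem_nbhd[of u "S - {s}" k z] by auto
      show "z \<in> slice F s"
      proof (rule ccontr)
        assume "z \<notin> slice F s"
        then have "f (s # u) = f (s # z)" using u zw s
          by (intro labellingD[OF f]) (auto simp: U_def A_def slice_def)
        then have "s # z \<in> A" using u zw s \<open>z \<notin> slice F s\<close> by (auto simp: U_def A_def slice_def)
        then show False using z by (auto simp: U_def)
      qed
    qed
    then have "card (NU - U) \<le> card (slice F s)" by (intro card_mono fin)
    moreover have "card NU \<le> card (NU - U) + card U" using diff_card_le_card_Diff[OF finU, of NU] by linarith
    ultimately have main: "card NU + card U \<le> card F" using cM by linarith
    have finNU: "finite NU" using S finU by (auto simp: NU_def)
    have two: "card NU \<ge> 4 * k - 1" if U2: "card U \<ge> 2"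
    proof -
      obtain x y where xy: "x \<in> U" "y \<in> U" "x \<noteq> y"
        using card_ge_2D[OF U2] by metis
      have "card (nbhd (S - {s}) x \<union> nbhd (S - {s}) y) \<ge> 4 * k - 1"
        by (rule card_nbhd_Un2_neq) (use xy Uw S s in auto)
      also have "card (nbhd (S - {s}) x \<union> nbhd (S - {s}) y) \<le> card NU"
        by (rule card_mono[OF finNU]) (use xy in \<open>auto simp: NU_def\<close>)
      finally show ?thesis .
    qed
    have lab: "card NU \<ge> 4 * k" if A2: "card (f ` A) \<ge> 2"
    proof -
      obtain p q where "p \<in> f ` A" "q \<in> f ` A" "p \<noteq> q" using card_ge_2D[OF A2] by metis
      then obtain x y where xy: "x \<in> U" "y \<in> U" "f (s # x) \<noteq> f (s # y)" unfolding AU by blast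
      have "\<not> near x y"
      proof
        assume "near x y"
        then have "f (s # x) = f (s # y)"
          by (intro labellingD[OF f]) (use xy in \<open>auto simp: U_def A_def\<close>)
        then show False using xy by simp
      qed
      then have "card (nbhd (S - {s}) x \<union> nbhd (S - {s}) y) \<ge> 4 * k"
        by (intro card_nbhd_Un2) (use xy Uw S s in auto)
      also have "card (nbhd (S - {s}) x \<union> nbhd (S - {s}) y) \<le> card NU"
        by (rule card_mono[OF finNU]) (use xy in \<open>auto simp: NU_def\<close>)
      finally show ?thesis .
    qed
    have "card (f ` A) \<le> card U" using card_image_le[OF finA, of f] cA by simp
    then show ?thesis using main two lab cA cF k by linarith
  next
    case (3 s t)
    \<comment> \<open>Two crowded slices leave at most \<open>card F - 4 * k\<close> faults
      elsewhere. Every exceptional tail is the tail of one of these, and words with the same tail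
      have the same label.\<close>
    define Z where "Z = F - ((#) s ` slice F s \<union> (#) t ` slice F t)"
    have "(#) s ` slice F s \<union> (#) t ` slice F t \<subseteq> F" by (auto simp: slice_def)
    moreover have "card ((#) s ` slice F s \<union> (#) t ` slice F t) = card (slice F s) + card (slice F t)"
      by (subst card_Un_disjoint) (use 3 fin in \<open>auto simp: card_image\<close>)
    ultimately have "card Z = card F - (card (slice F s) + card (slice F t))"
      unfolding Z_def using fin by (subst card_Diff_subset) auto
    moreover have "card (slice F s) \<ge> 2 * k" "card (slice F t) \<ge> 2 * k" using 3 by (auto simp: Bad_def)
    ultimately have cZ: "card Z \<le> card F - 4 * k" by linarith
    have tl: "tl ` A \<subseteq> tl ` Z"
    proof
      fix u assume "u \<in> tl ` A"
      then obtain w where w: "w \<in> A" "u = tl w" by blast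
      then obtain r where ru: "w = r # u" by (auto simp: A_def elim: in_words_SucE)
      have r: "r \<in> {s, t}" using Ahd[of r u] w(1) ru 3(1) by simp
      obtain a b where ab: "S - set w = {a, b}" "a \<noteq> b"
        using card_unused[of w S "Suc k"] w S by (auto simp: card_2_iff A_def)
      have "r \<notin> {a, b}" using ab ru by auto
      then obtain d where d: "d \<in> {a, b}" "d \<notin> {s, t}" using r ab(2) by auto
      have "d \<in> S - set (r # u)" using d(1) ab(1) ru by auto
      then have "d # u \<in> F" using mate[of r u d] w(1) ru d(2) 3(1) by auto
      then have "d # u \<in> Z" using d by (auto simp: Z_def)
      then show "u \<in> tl ` Z" by force
    qed
    have finZ: "finite Z" using finF by (simp add: Z_def)
    have "card (f ` A) \<le> card (tl ` A)"
    proof (rule card_image_factor_le[OF finA])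
      fix x y assume xy: "x \<in> A" "y \<in> A" "tl x = tl y"
      then obtain a b u where "x = a # u" "y = b # u" by (auto simp: A_def elim!: in_words_SucE)
      then show "f x = f y" using xy by (intro labellingD[OF f]) (auto simp: A_def)
    qed
    also have "\<dots> \<le> card (tl ` Z)" using tl finZ by (intro card_mono) auto
    also have "\<dots> \<le> card Z" by (rule card_image_le[OF finZ])
    finally have fA: "card (f ` A) \<le> card Z" .
    have "card A = 0" if "card F \<le> 4 * k"
      using that cZ tl finZ by (auto simp: card_eq_0_iff)
    then show ?thesis using fA cZ cF by linarith
  qed
  then show ?thesis using that[of c] by (simp add: A_def)
qed

section \<open>Words of length two over four symbols\<close>

lemma card_words_2:
  assumes "finite S" "card S = 4"
  shows "card (words S 2) = 12"
proof -
  have "{3..4::nat} = {3, 4}" by auto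
  then show ?thesis using card_words[of S 2] assms by simp
qed

lemma in_words_2: "x \<in> words S 2 \<longleftrightarrow> (\<exists>t s. x = [t, s] \<and> t \<in> S \<and> s \<in> S \<and> t \<noteq> s)"
  by (auto simp: words_def length_Suc_conv numeral_2_eq_2)

text \<open>Words of length two are cells of a board, with \<open>near\<close> as the move of a
  rook; over four symbols they are the 12 off-diagonal cells.\<close>

lemma near_2 [simp]: "near [t, s] [t', s'] \<longleftrightarrow> t = t' \<or> s = s'"
proof
  assume "near [t, s] [t', s']"
  then obtain i where i: "\<forall>j<2. j \<noteq> i \<longrightarrow> [t, s] ! j = [t', s'] ! j" by (auto simp: near_def numeral_2_eq_2)
  show "t = t' \<or> s = s'"
  proof (cases "i = 0")
    case True
    then show ?thesis using i[rule_format, of 1] by simp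
  next
    case False
    then show ?thesis using i[rule_format, of 0] by simp
  qed
next
  assume "t = t' \<or> s = s'"
  then show "near [t, s] [t', s']"
    unfolding near_def
    by (metis (no_types, lifting) One_nat_def length_Cons less_2_cases list.size(3) nth_Cons_0 nth_Cons_Suc numeral_2_eq_2)
qed

lemma card_S4_insert:
  assumes "finite S" "card S = 4" "a \<in> S" "b \<in> S" "c \<in> S" "a \<noteq> b" "a \<noteq> c" "b \<noteq> c"
  obtains d where "S = {a, b, c, d}" "d \<notin> {a, b, c}"
proof -
  have "card (S - {a, b, c}) = 1" using assms by (subst card_Diff_subset) auto
  then obtain d where "S - {a, b, c} = {d}" by (rule card_1_singletonE)
  then show ?thesis using that[of d] assms by blast
qed

text \<open>Representatives of three labels lie in different rows and columns, and a survivor in the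
  row of one and the column of another would identify two labels. Besides the representatives and
  the corner \<open>[t4, s4]\<close>, the fourth row and the fourth column keep at most one cell
  each, since cells in one line share a label. So at most 6 of 12 cells survive.\<close>

lemma labelling_words_2_three:
  assumes S: "finite S" "card S = 4" and F: "F \<subseteq> words S 2" and f: "labelling S 2 F f"
    and l: "card (f ` (words S 2 - F)) \<ge> 3"
  shows "card F \<ge> 6"
proof -
  define P where "P = words S 2 - F"
  have finP: "finite P" using S by (simp add: P_def)
  have fP: "f [t, s] = f [t', s']" if "[t, s] \<in> P" "[t', s'] \<in> P" "t = t' \<or> s = s'" for t s t' s'
    using that by (intro labellingD[OF f]) (auto simp: P_def)
  obtain a b c where "a \<in> f ` P" "b \<in> f ` P" "c \<in> f ` P" "a \<noteq> b" "a \<noteq> c" "b \<noteq> c"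
    using card_ge_3D l unfolding P_def by metis
  then obtain t1 s1 t2 s2 t3 s3 where x: "[t1, s1] \<in> P" "[t2, s2] \<in> P" "[t3, s3] \<in> P"
    and d: "f [t1, s1] \<noteq> f [t2, s2]" "f [t1, s1] \<noteq> f [t3, s3]" "f [t2, s2] \<noteq> f [t3, s3]"
    unfolding P_def by (auto simp: in_words_2)
  have t: "t1 \<noteq> t2" "t1 \<noteq> t3" "t2 \<noteq> t3" and s: "s1 \<noteq> s2" "s1 \<noteq> s3" "s2 \<noteq> s3" using d fP x by blast+
  have mem: "t1 \<in> S" "t2 \<in> S" "t3 \<in> S" "s1 \<in> S" "s2 \<in> S" "s3 \<in> S" using x by (auto simp: P_def in_words_2)
  obtain t4 where t4: "S = {t1, t2, t3, t4}" "t4 \<notin> {t1, t2, t3}"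
    using card_S4_insert[OF S mem(1-3) t] by metis
  obtain s4 where s4: "S = {s1, s2, s3, s4}" "s4 \<notin> {s1, s2, s3}"
    using card_S4_insert[OF S mem(4-6) s] by metis
  define X where "X = {x \<in> P. \<exists>q\<in>{s1, s2, s3}. x = [t4, q]}"
  define Y where "Y = {x \<in> P. \<exists>q\<in>{t1, t2, t3}. x = [q, s4]}"
  have fs: "f [q, s1] = f [t1, s1]" if "[q, s1] \<in> P" for q using fP that x by blast
  have fs2: "f [q, s2] = f [t2, s2]" if "[q, s2] \<in> P" for q using fP that x by blast
  have fs3: "f [q, s3] = f [t3, s3]" if "[q, s3] \<in> P" for q using fP that x by blast
  have ft: "f [t1, q] = f [t1, s1]" if "[t1, q] \<in> P" for q using fP that x by blast
  have ft2: "f [t2, q] = f [t2, s2]" if "[t2, q] \<in> P" for q using fP that x by blast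
  have ft3: "f [t3, q] = f [t3, s3]" if "[t3, q] \<in> P" for q using fP that x by blast
  have X1: "card X \<le> 1"
  proof -
    have "p = q" if pq: "p \<in> X" "q \<in> X" for p q
    proof -
      have "f p = f q" using pq by (auto simp: X_def intro!: fP)
      then show ?thesis using pq fs[of t4] fs2[of t4] fs3[of t4] d unfolding X_def by auto
    qed
    moreover have "finite X" using finP by (simp add: X_def)
    ultimately have "card X \<le> Suc 0" using card_le_Suc0_iff_eq by blast
    then show ?thesis by simp
  qed
  have Y1: "card Y \<le> 1"
  proof -
    have "p = q" if pq: "p \<in> Y" "q \<in> Y" for p q
    proof -
      have "f p = f q" using pq by (auto simp: Y_def intro!: fP)
      then show ?thesis using pq ft[of s4] ft2[of s4] ft3[of s4] d unfolding Y_def by auto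
    qed
    moreover have "finite Y" using finP by (simp add: Y_def)
    ultimately have "card Y \<le> Suc 0" using card_le_Suc0_iff_eq by blast
    then show ?thesis by simp
  qed
  have "P \<subseteq> {[t1, s1], [t2, s2], [t3, s3], [t4, s4]} \<union> X \<union> Y"
  proof
    fix x assume xP: "x \<in> P"
    then obtain p q where pq: "x = [p, q]" "p \<in> S" "q \<in> S" by (auto simp: P_def in_words_2)
    then have "p \<in> {t1, t2, t3, t4}" "q \<in> {s1, s2, s3, s4}" using t4(1) s4(1) by auto
    then show "x \<in> {[t1, s1], [t2, s2], [t3, s3], [t4, s4]} \<union> X \<union> Y"
      using xP pq(1) fs[of p] fs2[of p] fs3[of p] ft[of q] ft2[of q] ft3[of q] d unfolding X_def Y_def by auto
  qed
  then have "card P \<le> card ({[t1, s1], [t2, s2], [t3, s3], [t4, s4]} \<union> X \<union> Y)"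
    using finP by (intro card_mono) (auto simp: X_def Y_def)
  also have "\<dots> \<le> card ({[t1, s1], [t2, s2], [t3, s3], [t4, s4]}) + card X + card Y"
    by (meson add_mono card_Un_le le_refl le_trans)
  also have "\<dots> \<le> 4 + 1 + 1" using X1 Y1 by (intro add_mono) (auto simp: card_insert_if)
  finally have "card P \<le> 6" by simp
  moreover have "card P = 12 - card F"
    unfolding P_def using card_words_2[OF S] F by (subst card_Diff_subset) (auto intro: finite_subset[OF F] simp: S)
  ultimately show ?thesis by simp
qed

text \<open>Four representatives use up all rows and columns, so any other survivor would identify
  two labels and at most 4 of 12 cells remain.\<close>

lemma labelling_words_2_four:
  assumes S: "finite S" "card S = 4" and F: "F \<subseteq> words S 2" and f: "labelling S 2 F f"
    and l: "card (f ` (words S 2 - F)) \<ge> 4"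
  shows "card F \<ge> 8"
proof -
  define P where "P = words S 2 - F"
  have finP: "finite P" using S by (simp add: P_def)
  have fP: "f [t, s] = f [t', s']" if "[t, s] \<in> P" "[t', s'] \<in> P" "t = t' \<or> s = s'" for t s t' s'
    using that by (intro labellingD[OF f]) (auto simp: P_def)
  obtain a b c e where "a \<in> f ` P" "b \<in> f ` P" "c \<in> f ` P" "e \<in> f ` P" "a \<noteq> b" "a \<noteq> c" "b \<noteq> c" "a \<noteq> e" "b \<noteq> e" "c \<noteq> e"
    using card_ge_4D l unfolding P_def by metis
  then obtain t1 s1 t2 s2 t3 s3 t4 s4 where x: "[t1, s1] \<in> P" "[t2, s2] \<in> P" "[t3, s3] \<in> P" "[t4, s4] \<in> P"
    and d: "f [t1, s1] \<noteq> f [t2, s2]" "f [t1, s1] \<noteq> f [t3, s3]" "f [t2, s2] \<noteq> f [t3, s3]"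
      "f [t1, s1] \<noteq> f [t4, s4]" "f [t2, s2] \<noteq> f [t4, s4]" "f [t3, s3] \<noteq> f [t4, s4]"
    unfolding P_def by (auto simp: in_words_2)
  have t: "t1 \<noteq> t2" "t1 \<noteq> t3" "t2 \<noteq> t3" "t1 \<noteq> t4" "t2 \<noteq> t4" "t3 \<noteq> t4"
    and s: "s1 \<noteq> s2" "s1 \<noteq> s3" "s2 \<noteq> s3" "s1 \<noteq> s4" "s2 \<noteq> s4" "s3 \<noteq> s4" using d fP x by blast+
  have mem: "{t1, t2, t3, t4} \<subseteq> S" "{s1, s2, s3, s4} \<subseteq> S" using x by (auto simp: P_def in_words_2)
  have St: "S = {t1, t2, t3, t4}" by (rule card_seteq[symmetric, OF S(1) mem(1)]) (use t S in simp)
  have Ss: "S = {s1, s2, s3, s4}" by (rule card_seteq[symmetric, OF S(1) mem(2)]) (use s S in simp)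
  have fs: "f [q, s1] = f [t1, s1]" if "[q, s1] \<in> P" for q using fP that x by blast
  have fs2: "f [q, s2] = f [t2, s2]" if "[q, s2] \<in> P" for q using fP that x by blast
  have fs3: "f [q, s3] = f [t3, s3]" if "[q, s3] \<in> P" for q using fP that x by blast
  have fs4: "f [q, s4] = f [t4, s4]" if "[q, s4] \<in> P" for q using fP that x by blast
  have ft: "f [t1, q] = f [t1, s1]" if "[t1, q] \<in> P" for q using fP that x by blast
  have ft2: "f [t2, q] = f [t2, s2]" if "[t2, q] \<in> P" for q using fP that x by blast
  have ft3: "f [t3, q] = f [t3, s3]" if "[t3, q] \<in> P" for q using fP that x by blast
  have ft4: "f [t4, q] = f [t4, s4]" if "[t4, q] \<in> P" for q using fP that x by blast
  have "P \<subseteq> {[t1, s1], [t2, s2], [t3, s3], [t4, s4]}"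
  proof
    fix x assume xP: "x \<in> P"
    then obtain p q where pq: "x = [p, q]" "p \<in> S" "q \<in> S" by (auto simp: P_def in_words_2)
    then have "p \<in> {t1, t2, t3, t4}" "q \<in> {s1, s2, s3, s4}" using St Ss by auto
    then show "x \<in> {[t1, s1], [t2, s2], [t3, s3], [t4, s4]}"
      using xP pq(1) fs[of p] fs2[of p] fs3[of p] fs4[of p] ft[of q] ft2[of q] ft3[of q] ft4[of q] d by auto
  qed
  then have "card P \<le> card {[t1, s1], [t2, s2], [t3, s3], [t4, s4]}" by (intro card_mono) auto
  also have "\<dots> \<le> 4" by (auto simp: card_insert_if)
  finally have "card P \<le> 4" by simp
  moreover have "card P = 12 - card F"
    unfolding P_def using card_words_2[OF S] F by (subst card_Diff_subset) (auto intro: finite_subset[OF F] simp: S)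
  ultimately show ?thesis by simp
qed

text \<open>For the situation in which no word survives in both layers, so that the faults cover all
  words. At \<open>m = 2\<close> both sides are 12.\<close>

lemma card_words_ge:
  assumes "finite S" "card S = m + 2" "m \<ge> 2"
  shows "card (words S m) \<ge> 8 * m - 4"
proof -
  have "\<Prod>{3..m + 2} \<ge> 8 * m - 4"
    using assms(3)
  proof (induction m rule: dec_induct)
    case base
    have "{3..2 + 2::nat} = {3, 4}" by auto
    then show ?case by simp
  next
    case (step n)
    have "{3..Suc n + 2} = insert (n + 3) {3..n + 2}" by auto
    then have "\<Prod>{3..Suc n + 2} = (n + 3) * \<Prod>{3..n + 2}" by simp
    moreover have "(n + 3) * \<Prod>{3..n + 2} \<ge> 2 * (8 * n - 4)" using step by (intro mult_mono) auto
    moreover have "2 * (8 * n - 4) \<ge> 8 * Suc n - 4" using step(1) by simp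
    ultimately show ?case by linarith
  qed
  then show ?thesis using card_words[of S m] assms by simp
qed

section \<open>Neighbours of a fixed word\<close>

text \<open>For a neighbour \<open>d\<close> of \<open>v\<close>, this is what \<open>d\<close> adds
  to the neighbourhood of \<open>v\<close>: everything around \<open>d\<close> except the triangle
  through \<open>v\<close> and \<open>d\<close>.\<close>

definition outer :: "'a set \<Rightarrow> 'a list \<Rightarrow> 'a list \<Rightarrow> 'a list set" where
  "outer S v d = nbhd S d - nbhd S v"

lemma finite_outer [simp]: "finite S \<Longrightarrow> finite (outer S v d)"
  by (simp add: outer_def)

lemma card_outer:
  assumes "finite S" "card S = m + 2" "v \<in> words S m" "i < m" "x \<in> S - set v"
  shows "card (outer S v (v[i := x])) = 2 * m - 2"
proof -
  have w: "v[i := x] \<in> words S m" by (rule update_in_words[OF assms(3,5)])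
  have e: "outer S v (v[i := x]) = nbhd S (v[i := x]) - nbhd S v \<inter> nbhd S (v[i := x])"
    by (auto simp: outer_def)
  show ?thesis unfolding e
    using nbhd_overlap_adjacent(2)[OF assms(3,1,2,4,5)] card_nbhd[OF w assms(1,2)] assms(1)
    by (subst card_Diff_subset) auto
qed

text \<open>Changes of \<open>v\<close> at the same position share only their triangle, which lies
  in \<open>nbhd S v\<close>. At different positions the midpoints are \<open>v\<close> and
  \<open>v[i := x, j := y]\<close>; only the second can count, and it is injective only if
  \<open>x\<close> and \<open>y\<close> differ.\<close>

lemma outer_overlap:
  assumes "finite S" "card S = m + 2" "v \<in> words S m" "i < m" "x \<in> S - set v" "j < m" "y \<in> S - set v"
    and ne: "v[i := x] \<noteq> v[j := y]"
  shows "card (outer S v (v[i := x]) \<inter> outer S v (v[j := y])) \<le> 1"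
    and "i = j \<or> x = y \<Longrightarrow> outer S v (v[i := x]) \<inter> outer S v (v[j := y]) = {}"
proof -
  let ?d = "v[i := x]" and ?e = "v[j := y]"
  have l: "length v = m" using assms(3) by (simp add: words_def)
  have dw: "?d \<in> words S m" "?e \<in> words S m" by (rule update_in_words[OF assms(3,5)]) (rule update_in_words[OF assms(3,7)])
  have same: "outer S v ?d \<inter> outer S v ?e = {}" if "i = j"
  proof -
    have "x \<noteq> y" using ne that by auto
    then have y: "y \<in> S - set ?d" using assms(5,7) set_update_subset_insert[of v i x] by auto
    have e: "?e = ?d[i := y]" using that by simp
    have "nbhd S ?d \<inter> nbhd S ?e = insert ?d ((\<lambda>c. ?d[i := c]) ` (S - set ?d))"
      unfolding e by (rule nbhd_overlap_adjacent(1)[OF dw(1) assms(1,2,4) y])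
    then have "near v q" if "q \<in> nbhd S ?d \<inter> nbhd S ?e" for q using that by auto
    moreover have "q \<in> words S m" if "q \<in> nbhd S ?d \<inter> nbhd S ?e" for q
      using that nbhd_subset_words[OF dw(1)] by auto
    ultimately show ?thesis using mem_nbhd[OF assms(3)] unfolding outer_def by blast
  qed
  have vn: "v ! i \<noteq> x" "v ! i \<noteq> y" "v ! j \<noteq> x" "v ! j \<noteq> y" using assms(4-7) l nth_mem[of i v] nth_mem[of j v] by auto
  have diff: "q = v[i := x, j := y]" if q: "q \<in> outer S v ?d \<inter> outer S v ?e" and ij: "i \<noteq> j" for q
  proof -
    have nn: "\<not> near ?d ?e"
    proof
      assume "near ?d ?e"
      then obtain p where p: "\<forall>r<m. r \<noteq> p \<longrightarrow> ?d ! r = ?e ! r" using l by (auto simp: near_def)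
      then have "i = p" "j = p" using p[rule_format, of i] p[rule_format, of j] ij assms l vn by auto
      then show False using ij by simp
    qed
    have "q \<in> nbhd S ?d \<inter> nbhd S ?e" using q by (auto simp: outer_def)
    then obtain p where p: "p < m" "?d ! p \<noteq> ?e ! p" "q = ?d[p := ?e ! p]"
      using nbhd_overlap_far[OF dw nn] by metis
    have "p = i \<or> p = j" using p(2) by (metis nth_list_update_neq)
    moreover have "p \<noteq> i"
    proof
      assume "p = i"
      then have "q = v" using p(3) ij l by simp
      then show False using q self_in_nbhd[OF assms(3)] by (auto simp: outer_def)
    qed
    ultimately show ?thesis using p(3) assms l by simp
  qed
  show "card (outer S v ?d \<inter> outer S v ?e) \<le> 1"
  proof (cases "i = j")
    case True
    then show ?thesis using same by simp
  next
    case False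
    then have "outer S v ?d \<inter> outer S v ?e \<subseteq> {v[i := x, j := y]}" using diff by blast
    then have "card (outer S v ?d \<inter> outer S v ?e) \<le> card {v[i := x, j := y]}" by (intro card_mono) auto
    then show ?thesis by simp
  qed
  show "outer S v ?d \<inter> outer S v ?e = {}" if "i = j \<or> x = y"
  proof (cases "i = j")
    case False
    then have xy: "x = y" using that by simp
    show ?thesis
    proof (rule ccontr)
      assume "outer S v ?d \<inter> outer S v ?e \<noteq> {}"
      then obtain q where q: "q \<in> outer S v ?d \<inter> outer S v ?e" by blast
      then have "q = v[i := x, j := y]" using diff False by blast
      moreover have "distinct q" using q by (auto simp: outer_def nbhd_def words_def)
      ultimately have "v[i := x, j := y] ! i \<noteq> v[i := x, j := y] ! j"
        using False assms l by (simp add: nth_eq_iff_index_eq del: nth_list_update_eq nth_list_update_neq)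
      then show False using False assms l xy by simp
    qed
  qed (rule same)
qed

lemma card_Un4_ge:
  assumes "finite A" "finite B" "finite C" "finite E"
  shows "card (A \<union> B \<union> C \<union> E) + card (A \<inter> E) + card (B \<inter> E) + card (C \<inter> E) \<ge> card (A \<union> B \<union> C) + card E"
proof -
  have e: "(A \<union> B \<union> C) \<inter> E = (A \<inter> E) \<union> (B \<inter> E) \<union> (C \<inter> E)" by auto
  have "card ((A \<union> B \<union> C) \<inter> E) \<le> card (A \<inter> E) + card (B \<inter> E) + card (C \<inter> E)"
    unfolding e using card_Un_le[of "A \<inter> E \<union> B \<inter> E" "C \<inter> E"] card_Un_le[of "A \<inter> E" "B \<inter> E"] by linarith
  then show ?thesis using card_Un_Int[of "A \<union> B \<union> C" E] assms by auto
qed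

lemma outer_counts:
  assumes S: "finite S" "card S = m + 2" and v: "v \<in> words S m"
    and i: "i1 < m" "i2 < m" "i3 < m" and x: "x1 \<in> S - set v" "x2 \<in> S - set v" "x3 \<in> S - set v"
    and ne: "v[i1 := x1] \<noteq> v[i2 := x2]" "v[i1 := x1] \<noteq> v[i3 := x3]" "v[i2 := x2] \<noteq> v[i3 := x3]"
  defines "R1 \<equiv> outer S v (v[i1 := x1])" and "R2 \<equiv> outer S v (v[i2 := x2])" and "R3 \<equiv> outer S v (v[i3 := x3])"
  shows "card (R1 \<union> R2 \<union> R3) \<ge> 6 * m - 8"
    and "i1 = i2 \<Longrightarrow> card (R1 \<union> R2 \<union> R3) \<ge> 6 * m - 7"
    and "i1 = i2 \<Longrightarrow> card (R1 \<inter> R3) + card (R2 \<inter> R3) \<le> 1"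
proof -
  note ov = outer_overlap[OF S v]
  have o: "card (R1 \<inter> R2) \<le> 1" "card (R1 \<inter> R3) \<le> 1" "card (R2 \<inter> R3) \<le> 1"
    unfolding R1_def R2_def R3_def using ov(1)[OF i(1) x(1) i(2) x(2) ne(1)]
      ov(1)[OF i(1) x(1) i(3) x(3) ne(2)] ov(1)[OF i(2) x(2) i(3) x(3) ne(3)] by simp_all
  have z: "i1 = i2 \<or> x1 = x2 \<Longrightarrow> card (R1 \<inter> R2) = 0" "i1 = i3 \<or> x1 = x3 \<Longrightarrow> card (R1 \<inter> R3) = 0"
    "i2 = i3 \<or> x2 = x3 \<Longrightarrow> card (R2 \<inter> R3) = 0"
    unfolding R1_def R2_def R3_def using ov(2)[OF i(1) x(1) i(2) x(2) ne(1)]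
      ov(2)[OF i(1) x(1) i(3) x(3) ne(2)] ov(2)[OF i(2) x(2) i(3) x(3) ne(3)] by simp_all
  have c: "card R1 = 2 * m - 2" "card R2 = 2 * m - 2" "card R3 = 2 * m - 2"
    unfolding R1_def R2_def R3_def using card_outer[OF S v i(1) x(1)] card_outer[OF S v i(2) x(2)] card_outer[OF S v i(3) x(3)] by simp_all
  have fin: "finite R1" "finite R2" "finite R3" using S by (auto simp: R1_def R2_def R3_def)
  obtain a b where ab: "S - set v = {a, b}" using card_unused[OF v S] by (metis card_2_iff)
  then have two: "x1 = x2 \<or> x1 = x3 \<or> x2 = x3" using x by auto
  then have "card (R1 \<inter> R2) + card (R1 \<inter> R3) + card (R2 \<inter> R3) \<le> 2" using o z by linarith
  then show "card (R1 \<union> R2 \<union> R3) \<ge> 6 * m - 8" using card_Un3_ge[OF fin] c by linarith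
  show 3: "card (R1 \<inter> R3) + card (R2 \<inter> R3) \<le> 1" if "i1 = i2"
  proof -
    have "x1 \<noteq> x2" using ne(1) that by auto
    then show ?thesis using two o z by linarith
  qed
  show "card (R1 \<union> R2 \<union> R3) \<ge> 6 * m - 7" if "i1 = i2"
    using 3[OF that] z(1) that card_Un3_ge[OF fin] c by linarith
qed

text \<open>Removing \<open>D\<close> discounts the words that will be counted twice. What remains
  contains \<open>v\<close>, the outer parts of words of \<open>D\<close>, and for a word of
  \<open>D\<close> alone at its position also the other change of \<open>v\<close> there. Two words
  of \<open>D\<close> at one position lack such partners, hence the weaker first bound and the
  additional word \<open>b\<close> demanded by the second.\<close>

lemma card_closed_nbhd_minus_ge:
  assumes S: "finite S" "card S = m + 2" and m: "m \<ge> 3" and v: "v \<in> words S m"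
    and B: "B \<subseteq> words S m" "v \<notin> B"
  defines "D \<equiv> B \<inter> nbhd S v" and "N \<equiv> (\<Union>b\<in>B. nbhd S b)"
  assumes D3: "card D \<ge> 3"
  shows "card (N - D) \<ge> 6 * m - 5"
    and "(\<And>p q. p \<in> D \<Longrightarrow> q \<in> D \<Longrightarrow> p \<noteq> q \<Longrightarrow> near p q \<Longrightarrow> card D = 3 \<Longrightarrow>
            \<exists>b\<in>B - nbhd S v. \<forall>d\<in>D. \<not> near d b) \<Longrightarrow> card (N - D) \<ge> 6 * m - 4"
proof -
  have l: "length v = m" using v by (simp add: words_def)
  have finB: "finite B" using B S finite_subset finite_words by blast
  have finN: "finite N" using finB S by (simp add: N_def)
  have finD: "finite D" using finB by (simp add: D_def)
  have DN: "nbhd S d \<subseteq> N" if "d \<in> D" for d using that by (auto simp: D_def N_def)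
  have Dw: "d \<in> words S m" if "d \<in> D" for d using that B by (auto simp: D_def)
  have Dform: "\<exists>i x. i < m \<and> x \<in> S - set v \<and> d = v[i := x]" if "d \<in> D" for d
    using that nbhd_eq[OF v] B(2) by (auto simp: D_def)
  have form: "v[i := x] \<in> words S m \<and> v[i := x] \<in> nbhd S v \<and> v[i := x] \<noteq> v" if "i < m" "x \<in> S - set v" for i x
  proof -
    have "v[i := x] \<noteq> v" using that l set_update_memI[of i v x] by auto
    then show ?thesis using update_in_words[OF v that(2)] mem_nbhd[OF v] by auto
  qed
  have vN: "v \<in> N - D"
  proof -
    obtain d where d: "d \<in> D" using D3 by fastforce
    then have "v \<in> nbhd S d" using nbhd_sym[OF v Dw[OF d]] by (auto simp: D_def)
    then show ?thesis using DN[OF d] B(2) by (auto simp: D_def)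
  qed
  have R: "outer S v d \<subseteq> N - D - nbhd S v" if "d \<in> D" for d using DN[OF that] by (auto simp: outer_def D_def)
  have vv: "v \<in> nbhd S v" by (rule self_in_nbhd[OF v])
  have fin3: "finite (N - D)" using finN by simp
  have nearsame: "near (v[i := x]) (v[i := y])" for i x y
    using near_update[of "v[i := x]" i y] by simp
  have main: "card (N - D) \<ge> 6 * m - 4 \<or> card (N - D) \<ge> 6 * m - 5 \<and> card D = 3 \<and> (\<exists>p\<in>D. \<exists>q\<in>D. p \<noteq> q \<and> near p q) \<and>
     (\<forall>b\<in>B - nbhd S v. (\<forall>d\<in>D. \<not> near d b) \<longrightarrow> card (N - D) \<ge> 6 * m - 4)"
  proof (cases "\<exists>p\<in>D. \<exists>q\<in>D. p \<noteq> q \<and> near p q")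
    case True
    then obtain p q where pq: "p \<in> D" "q \<in> D" "p \<noteq> q" "near p q" by blast
    obtain i x where ix: "i < m" "x \<in> S - set v" "p = v[i := x]" using Dform pq by blast
    obtain j y where jy: "j < m" "y \<in> S - set v" "q = v[j := y]" using Dform pq by blast
    have ij: "j = i"
    proof (rule ccontr)
      assume ne: "j \<noteq> i"
      have vn: "v ! i \<noteq> x" "v ! j \<noteq> y" using ix jy l nth_mem[of i v] nth_mem[of j v] by auto
      obtain r where r: "\<forall>k<m. k \<noteq> r \<longrightarrow> p ! k = q ! k" using pq(4) ix l by (auto simp: near_def)
      then have "i = r" "j = r" using r[rule_format, of i] r[rule_format, of j] ne ix jy l vn by auto
      then show False using ne by simp
    qed
    have "card (D - {p, q}) \<ge> 1" using D3 pq finD by (subst card_Diff_subset) auto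
    then obtain d where "d \<in> D - {p, q}" by (metis all_not_in_conv card.empty not_one_le_zero)
    then have d: "d \<in> D" "d \<noteq> p" "d \<noteq> q" by auto
    obtain k z where kz: "k < m" "z \<in> S - set v" "d = v[k := z]" using Dform d by blast
    let ?R = "outer S v p \<union> outer S v q \<union> outer S v d"
    have ne: "v[i := x] \<noteq> v[j := y]" "v[i := x] \<noteq> v[k := z]" "v[j := y] \<noteq> v[k := z]"
      using pq(3) d(2,3) unfolding ix(3) jy(3) kz(3) by simp_all
    have R7: "card ?R \<ge> 6 * m - 7" unfolding ix(3) jy(3) kz(3)
      by (rule outer_counts(2)[OF S v ix(1) jy(1) kz(1) ix(2) jy(2) kz(2) ne ij[symmetric]])
    have Rsub: "?R \<subseteq> N - D - nbhd S v" using R pq d by blast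
    show ?thesis
    proof (cases "card D = 3")
      case False
      have "card (D - {p, q, d}) \<ge> 1" using False D3 pq d finD by (subst card_Diff_subset) auto
      then obtain e where "e \<in> D - {p, q, d}" by (metis all_not_in_conv card.empty not_one_le_zero)
      then have e: "e \<in> D" "e \<noteq> p" "e \<noteq> q" "e \<noteq> d" by auto
      obtain h t where ht: "h < m" "t \<in> S - set v" "e = v[h := t]" using Dform e by blast
      have o1: "card (outer S v p \<inter> outer S v e) + card (outer S v q \<inter> outer S v e) \<le> 1"
        unfolding ix(3) jy(3) ht(3)
        by (rule outer_counts(3)[OF S v ix(1) jy(1) ht(1) ix(2) jy(2) ht(2)])
          (use pq(3) e(2,3) ij in \<open>simp_all add: ix(3) jy(3) ht(3)\<close>)
      have o2: "card (outer S v d \<inter> outer S v e) \<le> 1"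
        unfolding kz(3) ht(3) by (rule outer_overlap(1)[OF S v kz(1,2) ht(1,2)]) (use e(4) in \<open>simp add: kz(3) ht(3)\<close>)
      have "card (outer S v e) = 2 * m - 2" unfolding ht(3) by (rule card_outer[OF S v ht(1,2)])
      then have "card (?R \<union> outer S v e) \<ge> 6 * m - 7 + (2 * m - 2) - 2"
        using card_Un4_ge[of "outer S v p" "outer S v q" "outer S v d" "outer S v e"] S o1 o2 R7 by auto
      \<comment> \<open>A fourth word adds \<open>2 * m - 2\<close> and loses at most 2;
        \<open>8 * m - 11\<close> reaches \<open>6 * m - 5\<close> from \<open>m = 3\<close>
        on.\<close>
      then have "card (?R \<union> outer S v e) \<ge> 6 * m - 5" using m by linarith
      moreover have "insert v (?R \<union> outer S v e) \<subseteq> N - D" using Rsub R[OF e(1)] vN by blast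
      moreover have "v \<notin> ?R \<union> outer S v e" using vv by (auto simp: outer_def)
      ultimately show ?thesis using card_mono[OF fin3, of "insert v (?R \<union> outer S v e)"] S m by auto
    next
      case True
      have De: "D = {p, q, d}"
        by (rule card_seteq[symmetric]) (use finD pq d True in auto)
      obtain a b where ab: "S - set v = {a, b}" "a \<noteq> b" using card_unused[OF v S] by (metis card_2_iff)
      then obtain z' where z': "z' \<in> S - set v" "z' \<noteq> z" by blast
      \<comment> \<open>The other change of \<open>v\<close> at the position of \<open>d\<close>. It
        is outside \<open>D\<close>, because \<open>p\<close> and \<open>q\<close> exhaust both
        changes at position \<open>i\<close> and so \<open>k\<close> differs from
        \<open>i\<close>.\<close>
      define e where "e = v[k := z']"
      have kne: "k \<noteq> i"
      proof
        assume "k = i"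
        then have "z \<noteq> x" "z \<noteq> y" "x \<noteq> y" using d pq kz ix jy ij by auto
        then show False using ab ix jy kz by auto
      qed
      have up: "v[s := r] = v[s' := r'] \<longleftrightarrow> s = s' \<and> r = r'" if "s < m" "s' < m" "r \<in> S - set v" "r' \<in> S - set v" for s s' r r'
        using that l by (intro update_eq_iff) auto
      have eD: "e \<notin> D" unfolding De e_def using up kne z' ix jy kz ij by auto
      have ev: "e \<noteq> v" "e \<in> nbhd S v" "e \<in> words S m" using form[OF kz(1) z'(1)] by (auto simp: e_def)
      have "e \<in> nbhd S d" using mem_nbhd[OF Dw[OF d(1)]] ev(3) nearsame kz(3) e_def by auto
      then have eN: "e \<in> N - D" using DN[OF d(1)] eD by auto
      have sub: "insert v (insert e ?R) \<subseteq> N - D" using Rsub vN eN by blast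
      have nin: "v \<notin> ?R" "e \<notin> ?R" using vv ev by (auto simp: outer_def)
      have c5: "card (insert v (insert e ?R)) \<ge> 6 * m - 5" using nin ev S R7 m by auto
      have "card (N - D) \<ge> 6 * m - 5" using c5 card_mono[OF fin3 sub] by linarith
      moreover have "card (N - D) \<ge> 6 * m - 4" if b: "b \<in> B - nbhd S v" "\<forall>d\<in>D. \<not> near d b" for b
      proof -
        have "b \<notin> insert v (insert e ?R)"
        proof -
          have "b \<noteq> v" "b \<noteq> e" using b vv ev by auto
          moreover have "b \<notin> ?R" using b De by (auto simp: outer_def nbhd_def)
          ultimately show ?thesis by auto
        qed
        moreover have "insert b (insert v (insert e ?R)) \<subseteq> N - D"
        proof -
          have "b \<in> nbhd S b" using self_in_nbhd b(1) B by blast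
          then have "b \<in> N - D" using b(1) by (auto simp: N_def D_def)
          then show ?thesis using sub by blast
        qed
        ultimately show ?thesis using c5 card_mono[OF fin3, of "insert b (insert v (insert e ?R))"] S m by auto
      qed
      ultimately show ?thesis using True pq by blast
    qed
  next
    case False
    obtain d1 d2 d3 where d: "d1 \<in> D" "d2 \<in> D" "d3 \<in> D" "d1 \<noteq> d2" "d1 \<noteq> d3" "d2 \<noteq> d3"
      using card_ge_3D[OF D3] by metis
    obtain i1 x1 where 1: "i1 < m" "x1 \<in> S - set v" "d1 = v[i1 := x1]" using Dform d by blast
    obtain i2 x2 where 2: "i2 < m" "x2 \<in> S - set v" "d2 = v[i2 := x2]" using Dform d by blast
    obtain i3 x3 where 3: "i3 < m" "x3 \<in> S - set v" "d3 = v[i3 := x3]" using Dform d by blast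
    have i: "i1 \<noteq> i2" "i1 \<noteq> i3" "i2 \<noteq> i3" using False d 1 2 3 nearsame by metis+
    let ?R = "outer S v d1 \<union> outer S v d2 \<union> outer S v d3"
    have R8: "card ?R \<ge> 6 * m - 8"
      unfolding 1(3) 2(3) 3(3)
      by (rule outer_counts(1)[OF S v 1(1) 2(1) 3(1) 1(2) 2(2) 3(2)]) (use d(4-6) in \<open>simp_all add: 1(3) 2(3) 3(3)\<close>)
    have Rsub: "?R \<subseteq> N - D - nbhd S v" using R d by blast
    show ?thesis
    proof (cases "card D = 3")
      case False': False
      have "card (D - {d1, d2, d3}) \<ge> 1" using False' D3 d finD by (subst card_Diff_subset) auto
      then obtain e where "e \<in> D - {d1, d2, d3}" by (metis all_not_in_conv card.empty not_one_le_zero)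
      then have e: "e \<in> D" "e \<noteq> d1" "e \<noteq> d2" "e \<noteq> d3" by auto
      obtain h t where ht: "h < m" "t \<in> S - set v" "e = v[h := t]" using Dform e by blast
      have h: "h \<noteq> i1" "h \<noteq> i2" "h \<noteq> i3" using False d e 1 2 3 ht nearsame by metis+
      \<comment> \<open>Pairwise non-adjacent words of \<open>D\<close> occupy different positions,
        so a fourth one forces \<open>m\<close> to be at least 4, which pays for a loss of
        3.\<close>
      have "card {i1, i2, i3, h} \<le> card {..<m}" using 1 2 3 ht by (intro card_mono) auto
      then have m4: "m \<ge> 4" using i h by auto
      have o: "card (outer S v d1 \<inter> outer S v e) \<le> 1" "card (outer S v d2 \<inter> outer S v e) \<le> 1"
        "card (outer S v d3 \<inter> outer S v e) \<le> 1"
        using outer_overlap(1)[OF S v 1(1,2) ht(1,2)] outer_overlap(1)[OF S v 2(1,2) ht(1,2)]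
          outer_overlap(1)[OF S v 3(1,2) ht(1,2)] e(2-4) unfolding 1(3) 2(3) 3(3) ht(3) by simp_all
      have "card (outer S v e) = 2 * m - 2" unfolding ht(3) by (rule card_outer[OF S v ht(1,2)])
      then have "card (?R \<union> outer S v e) \<ge> 6 * m - 8 + (2 * m - 2) - 3"
        using card_Un4_ge[of "outer S v d1" "outer S v d2" "outer S v d3" "outer S v e"] S o R8 by auto
      then have "card (?R \<union> outer S v e) \<ge> 6 * m - 5" using m4 by linarith
      moreover have "insert v (?R \<union> outer S v e) \<subseteq> N - D" using Rsub R[OF e(1)] vN by blast
      moreover have "v \<notin> ?R \<union> outer S v e" using vv by (auto simp: outer_def)
      ultimately show ?thesis using card_mono[OF fin3, of "insert v (?R \<union> outer S v e)"] S m by auto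
    next
      case True
      have De: "D = {d1, d2, d3}"
        by (rule card_seteq[symmetric]) (use finD d True in auto)
      obtain a b where ab: "S - set v = {a, b}" "a \<noteq> b" using card_unused[OF v S] by (metis card_2_iff)
      have up: "v[s := r] = v[s' := r'] \<longleftrightarrow> s = s' \<and> r = r'" if "s < m" "s' < m" "r \<in> S - set v" "r' \<in> S - set v" for s s' r r'
        using that l by (intro update_eq_iff) auto
      obtain y1 where y1: "y1 \<in> S - set v" "y1 \<noteq> x1" using ab by blast
      obtain y2 where y2: "y2 \<in> S - set v" "y2 \<noteq> x2" using ab by blast
      obtain y3 where y3: "y3 \<in> S - set v" "y3 \<noteq> x3" using ab by blast
      let ?E = "{v[i1 := y1], v[i2 := y2], v[i3 := y3]}"
      have Ew: "?E \<subseteq> words S m" "?E \<subseteq> nbhd S v" "v \<notin> ?E" 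
        using form[OF 1(1) y1(1)] form[OF 2(1) y2(1)] form[OF 3(1) y3(1)] by auto
      have "?E \<inter> D = {}" unfolding De 1(3) 2(3) 3(3)
        using up[OF 1(1) 1(1) y1(1) 1(2)] up[OF 1(1) 2(1) y1(1) 2(2)] up[OF 1(1) 3(1) y1(1) 3(2)]
          up[OF 2(1) 1(1) y2(1) 1(2)] up[OF 2(1) 2(1) y2(1) 2(2)] up[OF 2(1) 3(1) y2(1) 3(2)]
          up[OF 3(1) 1(1) y3(1) 1(2)] up[OF 3(1) 2(1) y3(1) 2(2)] up[OF 3(1) 3(1) y3(1) 3(2)]
          i y1(2) y2(2) y3(2) by simp
      moreover have "?E \<subseteq> N"
      proof -
        have "v[i1 := y1] \<in> nbhd S d1" "v[i2 := y2] \<in> nbhd S d2" "v[i3 := y3] \<in> nbhd S d3"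
          using Ew(1) mem_nbhd[OF Dw[OF d(1)]] mem_nbhd[OF Dw[OF d(2)]] mem_nbhd[OF Dw[OF d(3)]]
          by (simp_all add: 1(3) 2(3) 3(3) nearsame)
        then show ?thesis using DN[OF d(1)] DN[OF d(2)] DN[OF d(3)] by auto
      qed
      ultimately have sub: "insert v (?E \<union> ?R) \<subseteq> N - D" using Rsub vN by blast
      have "card (insert v (?E \<union> ?R)) = 1 + 3 + card ?R"
      proof -
        have ER: "?E \<inter> ?R = {}" using Ew(2) by (auto simp: outer_def)
        have E3: "card ?E = 3"
          using up[OF 1(1) 2(1) y1(1) y2(1)] up[OF 1(1) 3(1) y1(1) y3(1)] up[OF 2(1) 3(1) y2(1) y3(1)] i by simp
        have nin: "v \<notin> ?E \<union> ?R" using Ew(3) vv by (auto simp: outer_def)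
        have fin: "finite ?E" "finite ?R" using S by simp_all
        have "card (?E \<union> ?R) = 3 + card ?R" using card_Un_disjoint[OF fin ER] E3 by simp
        then show ?thesis using card_insert_disjoint[OF _ nin] fin by simp
      qed
      then have "card (N - D) \<ge> 6 * m - 4" using R8 m card_mono[OF fin3 sub] by linarith
      then show ?thesis by simp
    qed
  qed
  then show "card (N - D) \<ge> 6 * m - 5" by linarith
  show "card (N - D) \<ge> 6 * m - 4" if H: "\<And>p q. p \<in> D \<Longrightarrow> q \<in> D \<Longrightarrow> p \<noteq> q \<Longrightarrow> near p q \<Longrightarrow> card D = 3 \<Longrightarrow>
            \<exists>b\<in>B - nbhd S v. \<forall>d\<in>D. \<not> near d b"
    using main H by blast
qed

section \<open>Two layers\<close>

lemma not_near_if_labels_differ: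
  assumes "labelling S m F f" "x \<in> words S m - F" "y \<in> words S m - F" "f x \<noteq> f y"
  shows "\<not> near x y"
  using labellingD[OF assms(1-3)] assms(4) by blast

text \<open>One representative per label suffices, as representatives with different labels are
  non-adjacent. For \<open>k = 3\<close> one word is given away to obtain a formula linear in
  \<open>k\<close>.\<close>

lemma card_nbhd_labels_ge:
  assumes S: "finite S" "card S = m + 2" and m: "m \<ge> 1" and f: "labelling S m F f"
    and B: "B \<subseteq> words S m - F" and k: "k \<in> {2, 3, 4}" "card (f ` B) \<ge> k"
  shows "card (\<Union>b\<in>B. nbhd S b) \<ge> (2 * m - 2) * k + 4"
proof -
  have finB: "finite B" by (rule finite_subset[OF B]) (use S in simp)
  have finN: "finite (\<Union>b\<in>B. nbhd S b)" using finB S by simp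
  note nn = not_near_if_labels_differ[OF f]
  have Bw: "b \<in> words S m - F" "b \<in> words S m" if "b \<in> B" for b using that B by auto
  consider "k = 2" | "k = 3" | "k = 4" using k(1) by blast
  then show ?thesis
  proof cases
    case 1
    then obtain p q where "p \<in> f ` B" "q \<in> f ` B" "p \<noteq> q" using card_ge_2D k(2) by metis
    then obtain x y where xy: "x \<in> B" "y \<in> B" "f x \<noteq> f y" by blast
    have "card (nbhd S x \<union> nbhd S y) \<ge> 4 * m"
      using xy by (intro card_nbhd_Un2[OF S] nn Bw)
    moreover have "nbhd S x \<union> nbhd S y \<subseteq> (\<Union>b\<in>B. nbhd S b)" using xy by blast
    ultimately have "card (\<Union>b\<in>B. nbhd S b) \<ge> 4 * m" using card_mono[OF finN] order_trans by blast
    then show ?thesis using 1 m by (simp add: diff_mult_distrib)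
  next
    case 2
    then obtain p q r where "p \<in> f ` B" "q \<in> f ` B" "r \<in> f ` B" "p \<noteq> q" "p \<noteq> r" "q \<noteq> r" using card_ge_3D k(2) by metis
    then obtain x y z where xy: "x \<in> B" "y \<in> B" "z \<in> B" "f x \<noteq> f y" "f x \<noteq> f z" "f y \<noteq> f z" by blast
    have "card (nbhd S x \<union> nbhd S y \<union> nbhd S z) \<ge> 6 * m - 1"
      using xy by (intro card_nbhd_Un3[OF S] nn Bw)
    moreover have "nbhd S x \<union> nbhd S y \<union> nbhd S z \<subseteq> (\<Union>b\<in>B. nbhd S b)" using xy by blast
    ultimately have "card (\<Union>b\<in>B. nbhd S b) \<ge> 6 * m - 1" using card_mono[OF finN] order_trans by blast
    then show ?thesis using 2 m by (simp add: diff_mult_distrib)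
  next
    case 3
    then obtain p q r s where "p \<in> f ` B" "q \<in> f ` B" "r \<in> f ` B" "s \<in> f ` B" "p \<noteq> q" "p \<noteq> r" "q \<noteq> r" "p \<noteq> s" "q \<noteq> s" "r \<noteq> s"
      using card_ge_4D k(2) by metis
    then obtain x y z t where xy: "x \<in> B" "y \<in> B" "z \<in> B" "t \<in> B" "f x \<noteq> f y" "f x \<noteq> f z" "f y \<noteq> f z"
      "f x \<noteq> f t" "f y \<noteq> f t" "f z \<noteq> f t" by blast
    have "card (nbhd S x \<union> nbhd S y \<union> nbhd S z \<union> nbhd S t) \<ge> 8 * m - 4"
      using xy by (intro card_nbhd_Un4[OF S] nn Bw)
    moreover have "nbhd S x \<union> nbhd S y \<union> nbhd S z \<union> nbhd S t \<subseteq> (\<Union>b\<in>B. nbhd S b)" using xy by blast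
    ultimately have "card (\<Union>b\<in>B. nbhd S b) \<ge> 8 * m - 4" using card_mono[OF finN] order_trans by blast
    then show ?thesis using 3 m by (simp add: diff_mult_distrib)
  qed
qed

text \<open>A surviving word of the boundary would inherit the label. As \<open>P\<close> sees
  labels only, \<open>B\<close> is a union of whole label classes.\<close>

lemma nbhd_of_label_class:
  assumes f: "labelling S m F f" and B: "B = {x \<in> words S m - F. P (f x)}"
  shows "(\<Union>b\<in>B. nbhd S b) - B \<subseteq> F"
proof
  fix z assume z: "z \<in> (\<Union>b\<in>B. nbhd S b) - B"
  then obtain b where b: "b \<in> B" "z \<in> nbhd S b" by blast
  then have bw: "b \<in> words S m - F" "P (f b)" using B by auto
  then have zw: "z \<in> words S m" "near b z" using mem_nbhd[of b S m z] b(2) by auto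
  show "z \<in> F"
  proof (rule ccontr)
    assume "z \<notin> F"
    then have "f b = f z" using zw bw by (intro labellingD[OF f]) auto
    then have "z \<in> B" using bw zw \<open>z \<notin> F\<close> B by auto
    then show False using z by simp
  qed
qed

lemma subset_nbhd_Union:
  assumes "B \<subseteq> words S m"
  shows "B \<subseteq> (\<Union>b\<in>B. nbhd S b)"
  using assms self_in_nbhd by blast

text \<open>Here \<open>v\<close> carries its label into the second layer, so at least
  \<open>k\<close> labels occur in \<open>B\<close>. The first layer has a faulty copy of
  \<open>B\<close> except for \<open>v\<close>: one fault less than the closed neighbourhood
  argument needs, to be recovered in two ways.\<close>

lemma layers_lower_bound_exception_alive:
  assumes S: "finite S" "card S = m + 2" and m: "m \<ge> 3" and k: "k \<in> {3, 4}"
    and F: "F0 \<subseteq> words S m" "F1 \<subseteq> words S m"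
    and f: "labelling S m F0 f0" "labelling S m F1 f1"
    and agree: "\<And>x. x \<in> words S m - F0 - F1 \<Longrightarrow> f0 x = f1 x"
    and many: "card (f0 ` (words S m - F0) \<union> f1 ` (words S m - F1)) \<ge> k + 1"
    and A: "{w \<in> words S m - F0. f0 w \<noteq> c} = {v}"
    and v1: "v \<notin> F1"
  shows "card F0 + card F1 \<ge> (2 * m - 2) * k + 4"
proof -
  define B where "B = {x \<in> words S m - F1. f1 x \<noteq> c}"
  define N where "N = (\<Union>b\<in>B. nbhd S b)"
  have fin: "finite F0" "finite F1" "finite B" using F S finite_subset[OF _ finite_words] by (auto simp: B_def)
  have finN: "finite N" using fin S by (simp add: N_def)
  have v: "v \<in> words S m" "v \<notin> F0" "f0 v \<noteq> c" using A by auto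
  have f01: "f0 v = f1 v" using agree[of v] v v1 by blast
  have vB: "v \<in> B" using v v1 f01 by (auto simp: B_def)
  have Bw: "B \<subseteq> words S m" "B \<subseteq> words S m - F1" by (auto simp: B_def)
  have BF: "B - {v} \<subseteq> F0"
  proof
    fix x assume x: "x \<in> B - {v}"
    show "x \<in> F0"
    proof (rule ccontr)
      assume nF: "x \<notin> F0"
      then have "f0 x = f1 x" using agree[of x] x by (auto simp: B_def)
      then have "x \<in> {w \<in> words S m - F0. f0 w \<noteq> c}" using x nF by (auto simp: B_def)
      then show False using A x by blast
    qed
  qed
  have vF: "nbhd S v - {v} \<subseteq> F0"
  proof
    fix z assume z: "z \<in> nbhd S v - {v}"
    then have zw: "z \<in> words S m" "near v z" using mem_nbhd[OF v(1)] by auto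
    show "z \<in> F0"
    proof (rule ccontr)
      assume "z \<notin> F0"
      then have "f0 v = f0 z" using zw v by (intro labellingD[OF f(1)]) auto
      then have "z \<in> {w \<in> words S m - F0. f0 w \<noteq> c}" using zw v \<open>z \<notin> F0\<close> by auto
      then show False using A z by blast
    qed
  qed
  have NB: "N - B \<subseteq> F1" unfolding N_def by (rule nbhd_of_label_class[OF f(2) B_def])
  have cN: "card N \<le> card F1 + card B"
    using diff_card_le_card_Diff[OF fin(3), of N] card_mono[OF fin(2) NB] by linarith
  have "f0 ` (words S m - F0) \<union> f1 ` (words S m - F1) \<subseteq> insert c (f1 ` B)"
  proof -
    have "f0 x \<in> insert c (f1 ` B)" if "x \<in> words S m - F0" for x
      using that A f01 vB by (cases "f0 x = c") auto
    moreover have "f1 x \<in> insert c (f1 ` B)" if "x \<in> words S m - F1" for x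
      using that by (auto simp: B_def)
    ultimately show ?thesis by blast
  qed
  then have "card (f0 ` (words S m - F0) \<union> f1 ` (words S m - F1)) \<le> card (insert c (f1 ` B))"
    by (rule card_mono[rotated]) (simp add: fin(3))
  then have "k + 1 \<le> card (insert c (f1 ` B))" using many by linarith
  then have fB: "card (f1 ` B) \<ge> k" using card_insert_le_m1[of "Suc (card (f1 ` B))" "f1 ` B" c] by simp
  show ?thesis
  proof (cases "nbhd S v \<subseteq> B")
    case False
    then obtain z where z: "z \<in> nbhd S v" "z \<notin> B" by blast
    \<comment> \<open>A neighbour of \<open>v\<close> outside \<open>B\<close> is a further fault of
      the first layer and replaces the missing copy of \<open>v\<close>.\<close>
    have "insert z (B - {v}) \<subseteq> F0" using vF BF z vB by blast
    then have "card (insert z (B - {v})) \<le> card F0" by (intro card_mono fin)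
    moreover have "card (insert z (B - {v})) = card B"
      using z vB fin(3) card_Suc_Diff1[OF fin(3) vB] by simp
    moreover have "card N \<ge> (2 * m - 2) * k + 4"
      unfolding N_def by (rule card_nbhd_labels_ge[OF S _ f(2) Bw(2)]) (use m k fB in auto)
    ultimately show ?thesis using cN by linarith
  next
    case True
    \<comment> \<open>Now the whole neighbourhood of \<open>v\<close> lies in one class, hence is
      disjoint from the closed neighbourhood of the classes with other labels. This gains 3 over the
      bound, against the missing 1.\<close>
    define B' where "B' = {x \<in> B. f1 x \<noteq> f1 v}"
    define N' where "N' = (\<Union>b\<in>B'. nbhd S b)"
    have B'w: "B' \<subseteq> words S m - F1" by (auto simp: B'_def B_def)
    have "f1 ` B \<subseteq> insert (f1 v) (f1 ` B')" by (auto simp: B'_def)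
    then have "card (f1 ` B) \<le> card (insert (f1 v) (f1 ` B'))" using fin(3) by (intro card_mono) (auto simp: B'_def)
    then have "card (f1 ` B') \<ge> k - 1" using fB card_insert_le_m1[of "Suc (card (f1 ` B'))" "f1 ` B'" "f1 v"] by simp
    then have "card N' \<ge> (2 * m - 2) * (k - 1) + 4"
      unfolding N'_def by (intro card_nbhd_labels_ge[OF S _ f(2) B'w]) (use m k in auto)
    moreover have "nbhd S v \<inter> N' = {}"
    proof (rule ccontr)
      assume "nbhd S v \<inter> N' \<noteq> {}"
      then obtain z b where zb: "z \<in> nbhd S v" "b \<in> B'" "z \<in> nbhd S b" by (auto simp: N'_def)
      have z: "z \<in> words S m - F1" using zb(1) True Bw(2) by blast
      have b: "b \<in> words S m - F1" "f1 b \<noteq> f1 v" using zb(2) by (auto simp: B'_def B_def)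
      have "f1 v = f1 z"
        using z v v1 zb(1) by (intro labellingD[OF f(2)]) (auto simp: nbhd_def)
      moreover have "f1 b = f1 z"
        using z b zb(3) by (intro labellingD[OF f(2)]) (auto simp: nbhd_def)
      ultimately show False using b(2) by simp
    qed
    moreover have "nbhd S v \<union> N' \<subseteq> N" using vB by (auto simp: N_def N'_def B'_def)
    moreover have "finite N'" using fin(3) S by (auto simp: N'_def B'_def)
    ultimately have "2 * m + 1 + ((2 * m - 2) * (k - 1) + 4) \<le> card N"
      using card_Un_disjoint[of "nbhd S v" N'] card_mono[OF finN, of "nbhd S v \<union> N'"] card_nbhd[OF v(1) S] S(1) by simp
    moreover have "(2 * m - 2) * k = (2 * m - 2) * (k - 1) + (2 * m - 2)" using k by auto
    moreover have "card B - 1 \<le> card F0" using card_mono[OF fin(1) BF] vB fin(3) by simp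
    ultimately show ?thesis using cN by linarith
  qed
qed

text \<open>With \<open>k - 1\<close> labels the closed neighbourhood bound is short by
  \<open>2 * m - 2\<close>. The faulty neighbours of \<open>v\<close> contribute
  \<open>2 * m\<close>, minus those already counted as copies of \<open>B\<close>, which form
  \<open>D\<close>.\<close>

lemma layers_lower_bound_exception_dead:
  assumes S: "finite S" "card S = m + 2" and m: "m \<ge> 3" and k: "k \<in> {3, 4}"
    and F: "F0 \<subseteq> words S m" "F1 \<subseteq> words S m"
    and f: "labelling S m F1 f1"
    and B: "B = {x \<in> words S m - F1. f1 x \<notin> L}" "B \<subseteq> F0" "card (f1 ` B) \<ge> k - 1"
    and v: "v \<in> words S m" "v \<in> F1" "nbhd S v - {v} \<subseteq> F0"
  shows "card F0 + card F1 \<ge> (2 * m - 2) * k + 4"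
proof -
  define N where "N = (\<Union>b\<in>B. nbhd S b)"
  define D where "D = B \<inter> nbhd S v"
  have Bw: "B \<subseteq> words S m" "B \<subseteq> words S m - F1" using B(1) by auto
  have fin: "finite F0" "finite F1" "finite B" using F S finite_subset[OF _ finite_words] B(2) by blast+
  have finN: "finite N" using fin S by (simp add: N_def)
  have vB: "v \<notin> B" using v(2) B(1) by auto
  have NB: "N - B \<subseteq> F1" unfolding N_def by (rule nbhd_of_label_class[OF f B(1)])
  have BN: "B \<subseteq> N" unfolding N_def by (rule subset_nbhd_Union[OF Bw(1)])
  have cN: "card N = card (N - B) + card B" using card_Diff_subset[OF fin(3) BN] card_mono[OF finN BN] by simp
  have cF1: "card (N - B) \<le> card F1" by (rule card_mono[OF fin(2) NB])
  have vv: "v \<in> nbhd S v" by (rule self_in_nbhd[OF v(1)])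
  have Dv: "B \<inter> (nbhd S v - {v}) = D" using vB by (auto simp: D_def)
  have "card (B \<union> (nbhd S v - {v})) + card D = card B + 2 * m"
    using card_Un_Int[of B "nbhd S v - {v}"] fin(3) S(1) card_nbhd[OF v(1) S] vv Dv by simp
  moreover have "card (B \<union> (nbhd S v - {v})) \<le> card F0" using B(2) v(3) by (intro card_mono fin) auto
  ultimately have sum: "card N + 2 * m \<le> card F0 + card F1 + card D" using cN cF1 by linarith
  have kk: "(2 * m - 2) * k = (2 * m - 2) * (k - 1) + (2 * m - 2)" using k by auto
  have N1: "card N \<ge> (2 * m - 2) * (k - 1) + 4"
    unfolding N_def by (rule card_nbhd_labels_ge[OF S _ f Bw(2)]) (use m k B(3) in auto)
  show ?thesis
  proof (cases "card D \<le> 2")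
    case True
    then show ?thesis using sum N1 kk m by linarith
  next
    case False
    then have D3: "card (B \<inter> nbhd S v) \<ge> 3" by (simp add: D_def)
    note G = card_closed_nbhd_minus_ge[OF S m v(1) Bw(1) vB D3]
    have DN: "D \<subseteq> N" using BN by (auto simp: D_def)
    have finD: "finite D" using fin by (simp add: D_def)
    have cD: "card N = card (N - D) + card D" using card_Diff_subset[OF finD DN] card_mono[OF finN DN] by simp
    have "card (N - D) + 2 * m \<ge> (2 * m - 2) * k + 4"
    proof (cases "k = 3")
      case True
      then show ?thesis using G(1) m unfolding N_def D_def by (simp add: diff_mult_distrib)
    next
      case False
      then have k4: "k = 4" using k by simp
      \<comment> \<open>For \<open>k = 4\<close> exactly this much is required. If \<open>D\<close>
        consists of three words, two of them adjacent, it carries at most two of the at least three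
        labels of \<open>B\<close>; a word with another label is near none of
        \<open>D\<close>.\<close>
      have "card (N - D) \<ge> 6 * m - 4"
        unfolding N_def D_def
      proof (rule G(2))
        fix p q assume pq: "p \<in> B \<inter> nbhd S v" "q \<in> B \<inter> nbhd S v" "p \<noteq> q" "near p q" "card (B \<inter> nbhd S v) = 3"
        have fpq: "f1 p = f1 q" by (rule labellingD[OF f]) (use pq Bw in auto)
        have "f1 ` D \<subseteq> f1 ` (D - {q})"
        proof
          fix y assume "y \<in> f1 ` D"
          then obtain x where x: "x \<in> D" "y = f1 x" by blast
          show "y \<in> f1 ` (D - {q})"
          proof (cases "x = q")
            case True
            have "p \<in> D - {q}" using pq by (auto simp: D_def)
            then show ?thesis using True x fpq by (metis imageI)
          next
            case False
            then show ?thesis using x by blast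
          qed
        qed
        then have "card (f1 ` D) \<le> card (f1 ` (D - {q}))" using finD by (intro card_mono) auto
        also have "\<dots> \<le> card (D - {q})" using finD by (intro card_image_le) auto
        also have "\<dots> = 2" using pq finD by (simp add: D_def)
        finally have "card (f1 ` D) < card (f1 ` B)" using B(3) k4 by simp
        then have "\<not> f1 ` B \<subseteq> f1 ` D" using finD by (metis card_mono finite_imageI linorder_not_less)
        then obtain b where b: "b \<in> B" "f1 b \<notin> f1 ` D" by blast
        have "\<not> near d b" if "d \<in> D" for d
        proof
          assume "near d b"
          then have "f1 d = f1 b" using that b Bw by (intro labellingD[OF f]) (auto simp: D_def)
          then show False using b that by (metis imageI)
        qed
        moreover have "b \<notin> nbhd S v" using b by (auto simp: D_def)
        ultimately show "\<exists>b\<in>B - nbhd S v. \<forall>d\<in>B \<inter> nbhd S v. \<not> near d b" using b(1) unfolding D_def by blast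
      qed
      then show ?thesis using k4 m by (simp add: diff_mult_distrib)
    qed
    then show ?thesis using sum cD by linarith
  qed
qed

lemma layers_lower_bound_le:
  assumes S: "finite S" "card S = m + 2" and m: "m \<ge> 2" and k: "k \<in> {2, 3, 4}"
    and F: "F0 \<subseteq> words S m" "F1 \<subseteq> words S m"
    and f: "labelling S m F0 f0" "labelling S m F1 f1"
    and agree: "\<And>x. x \<in> words S m - F0 - F1 \<Longrightarrow> f0 x = f1 x"
    and many: "card (f0 ` (words S m - F0) \<union> f1 ` (words S m - F1)) \<ge> k + 1"
    and le: "card F0 \<le> card F1"
  shows "card F0 + card F1 \<ge> (2 * m - 2) * k + 4"
proof (rule ccontr)
  assume neg: "\<not> ?thesis"
  define L0 where "L0 = f0 ` (words S m - F0)"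
  define L1 where "L1 = f1 ` (words S m - F1)"
  define B where "B = {x \<in> words S m - F1. f1 x \<notin> L0}"
  define N where "N = (\<Union>b\<in>B. nbhd S b)"
  have fin: "finite F0" "finite F1" using F S finite_subset[OF _ finite_words] by blast+
  have finL: "finite L0" "finite L1" "finite B" using S by (auto simp: L0_def L1_def B_def)
  have finN: "finite N" using finL S by (simp add: N_def)
  have Bw: "B \<subseteq> words S m - F1" by (auto simp: B_def)
  have BF: "B \<subseteq> F0"
  proof
    fix x assume x: "x \<in> B"
    show "x \<in> F0"
    proof (rule ccontr)
      assume nF: "x \<notin> F0"
      then have "f0 x = f1 x" using agree[of x] x by (auto simp: B_def)
      moreover have "f0 x \<in> L0" using x nF by (auto simp: B_def L0_def)
      ultimately show False using x by (auto simp: B_def)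
    qed
  qed
  have fB: "f1 ` B = L1 - L0" by (auto simp: B_def L1_def)
  have "L0 \<union> L1 = L0 \<union> f1 ` B" using fB by blast
  then have cB: "k + 1 \<le> card L0 + card (f1 ` B)"
    using many card_Un_le[of L0 "f1 ` B"] unfolding L0_def[symmetric] L1_def[symmetric] by simp
  have NB: "N - B \<subseteq> F1" unfolding N_def by (rule nbhd_of_label_class[OF f(2) B_def])
  have cN: "card N \<le> card F1 + card F0"
    using diff_card_le_card_Diff[OF finL(3), of N] card_mono[OF fin(2) NB] card_mono[OF fin(1) BF] by linarith
  have a: "card L0 \<ge> 2"
  proof (rule ccontr)
    assume "\<not> card L0 \<ge> 2"
    then have "card (f1 ` B) \<ge> k" using cB by simp
    then have "card N \<ge> (2 * m - 2) * k + 4"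
      unfolding N_def by (intro card_nbhd_labels_ge[OF S _ f(2) Bw k]) (use m in auto)
    then show False using neg cN by simp
  qed
  have T: "(2 * m - 2) * k + 4 \<le> 8 * m - 4"
    using k m by (auto simp: diff_mult_distrib)
  \<comment> \<open>The layers share a label, since otherwise no word would survive in both and the
    faults would cover all words.\<close>
  have b: "card L0 + card L1 \<ge> k + 2"
  proof (rule ccontr)
    assume "\<not> card L0 + card L1 \<ge> k + 2"
    then have "card L1 \<le> card (L1 - L0)" using cB fB by simp
    then have "L1 - L0 = L1" using card_seteq[OF finL(2), of "L1 - L0"] by blast
    then have "words S m - F1 \<subseteq> B" by (auto simp: B_def L1_def)
    then have "words S m \<subseteq> F0 \<union> F1" using BF by blast
    then have "card (words S m) \<le> card (F0 \<union> F1)" by (rule card_mono[rotated]) (simp add: fin)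
    then have "card (words S m) \<le> card F0 + card F1" using card_Un_le[of F0 F1] by linarith
    then show False using card_words_ge[OF S m] neg T by linarith
  qed
  have F0ge: "card F0 \<ge> 2 * m"
  proof (rule ccontr)
    assume lt: "\<not> card F0 \<ge> 2 * m"
    obtain p q where "p \<in> L0" "q \<in> L0" "p \<noteq> q" using card_ge_2D[OF a] by metis
    then obtain x y where xy: "x \<in> words S m - F0" "y \<in> words S m - F0" "f0 x \<noteq> f0 y" unfolding L0_def by blast
    then show False using labelling_constant[OF S F(1) f(1) _ xy(1,2)] lt by simp
  qed
  have k34: "k \<in> {3, 4}"
  proof -
    have "k \<noteq> 2" using neg F0ge le m by (auto simp: diff_mult_distrib)
    then show ?thesis using k by simp
  qed
  consider "m = 2" | "m \<ge> 3" using m by linarith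
  then show False
  proof cases
    case 1
    then have S4: "card S = 4" using S by simp
    note F' = F[unfolded 1] and f' = f[unfolded 1]
    have l0: "\<not> card L0 \<ge> 3 \<or> card F0 \<ge> 6" "\<not> card L1 \<ge> 3 \<or> card F1 \<ge> 6" "\<not> card L1 \<ge> 4 \<or> card F1 \<ge> 8"
      using labelling_words_2_three[OF S(1) S4 F'(1) f'(1)] labelling_words_2_three[OF S(1) S4 F'(2) f'(2)]
        labelling_words_2_four[OF S(1) S4 F'(2) f'(2)] unfolding L0_def L1_def 1 by blast+
    \<comment> \<open>The layers have at most 4 and 5 faults for \<open>k = 3\<close>, and at most 5
      and 7 for \<open>k = 4\<close>. They show at most 2 and 2, respectively 2 and 3 labels, fewer
      than \<open>k + 2\<close> in total.\<close>
    show ?thesis using k34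
    proof
      assume k3: "k = 3"
      then have "card F0 + card F1 < 10" using neg 1 by simp
      then show ?thesis using l0 b F0ge le k3 1 by linarith
    next
      assume "k \<in> {4}"
      then have k4: "k = 4" by simp
      then have "card F0 + card F1 < 12" using neg 1 by simp
      then show ?thesis using l0 b F0ge le k4 1 by linarith
    qed
  next
    case 2
    then obtain m' where m': "m = Suc m'" "m' \<ge> 2" by (cases m) auto
    have Sm: "card S = m' + 3" using S m' by simp
    note st = labelling_structure[OF S(1) Sm _ _ m'(2)]
    have neg': "card F0 + card F1 < (2 * m - 2) * k + 4" using neg by simp
    show ?thesis
    proof (cases "card F0 \<le> 4 * m'")
      case False
      \<comment> \<open>Fewer than \<open>8 * m' + 4\<close> faults split almost evenly, with
        \<open>4 * m' + 1\<close> and at most \<open>4 * m' + 2\<close>. The layers then show at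
        most 2 and 3 labels, against the required 6.\<close>
      then have k4: "k = 4" and cF: "card F0 \<le> 4 * m' + 1" "card F1 \<le> 4 * m' + 2"
        using k34 neg' le m' by auto
      obtain c where c: "card (f0 ` {w \<in> words S m - F0. f0 w \<noteq> c}) \<le> 1"
        using st[OF F(1)[unfolded m'(1)] f(1)[unfolded m'(1)]] cF unfolding m'(1) by (metis le_SucI add_2_eq_Suc' Suc_eq_plus1)
      obtain d where d: "card (f1 ` {w \<in> words S m - F1. f1 w \<noteq> d}) \<le> 2"
        using st[OF F(2)[unfolded m'(1)] f(2)[unfolded m'(1)] cF(2)] unfolding m'(1) by metis
      have "L0 \<subseteq> insert c (f0 ` {w \<in> words S m - F0. f0 w \<noteq> c})" by (auto simp: L0_def)
      then have "card L0 \<le> card (insert c (f0 ` {w \<in> words S m - F0. f0 w \<noteq> c}))" using S by (intro card_mono) auto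
      also have "\<dots> \<le> Suc (card (f0 ` {w \<in> words S m - F0. f0 w \<noteq> c}))" by (rule card_insert_le_m1) auto
      finally have L0: "card L0 \<le> 2" using c by simp
      have "L1 \<subseteq> insert d (f1 ` {w \<in> words S m - F1. f1 w \<noteq> d})" by (auto simp: L1_def)
      then have "card L1 \<le> card (insert d (f1 ` {w \<in> words S m - F1. f1 w \<noteq> d}))" using S by (intro card_mono) auto
      also have "\<dots> \<le> Suc (card (f1 ` {w \<in> words S m - F1. f1 w \<noteq> d}))" by (rule card_insert_le_m1) auto
      finally have L1: "card L1 \<le> 3" using d by simp
      show ?thesis using L0 L1 b k4 by simp
    next
      case True
      obtain c where c: "card {w \<in> words S m - F0. f0 w \<noteq> c} \<le> 1"
        using st[OF F(1)[unfolded m'(1)] f(1)[unfolded m'(1)] trans_le_add1[OF True]] True unfolding m'(1) by metis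
      have "{w \<in> words S m - F0. f0 w \<noteq> c} \<noteq> {}"
      proof
        assume "{w \<in> words S m - F0. f0 w \<noteq> c} = {}"
        then have "L0 \<subseteq> {c}" by (auto simp: L0_def)
        then have "card L0 \<le> card {c}" by (intro card_mono) auto
        then show False using a by simp
      qed
      moreover have "finite {w \<in> words S m - F0. f0 w \<noteq> c}" using S by simp
      ultimately have "card {w \<in> words S m - F0. f0 w \<noteq> c} > 0" by (simp only: card_gt_0_iff) simp
      then have "card {w \<in> words S m - F0. f0 w \<noteq> c} = 1" using c by linarith
      then obtain v where v: "{w \<in> words S m - F0. f0 w \<noteq> c} = {v}" by (rule card_1_singletonE)
      have vw: "v \<in> words S m" "v \<notin> F0" "f0 v \<noteq> c" using v by auto
      show ?thesis
      proof (cases "v \<in> F1")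
        case False
        then show ?thesis
          using layers_lower_bound_exception_alive[OF S 2 k34 F f agree many v] neg by blast
      next
        case v1: True
        have vF: "nbhd S v - {v} \<subseteq> F0"
        proof
          fix z assume z: "z \<in> nbhd S v - {v}"
          then have zw: "z \<in> words S m" "near v z" using mem_nbhd[OF vw(1)] by auto
          show "z \<in> F0"
          proof (rule ccontr)
            assume "z \<notin> F0"
            then have "f0 v = f0 z" using zw vw by (intro labellingD[OF f(1)]) auto
            then have "z \<in> {w \<in> words S m - F0. f0 w \<noteq> c}" using zw vw \<open>z \<notin> F0\<close> by auto
            then show False using v z by blast
          qed
        qed
        have "L0 \<subseteq> {c, f0 v}"
        proof
          fix y assume "y \<in> L0"
          then obtain x where x: "x \<in> words S m - F0" "y = f0 x" by (auto simp: L0_def)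
          show "y \<in> {c, f0 v}"
          proof (cases "f0 x = c")
            case False
            then have "x \<in> {w \<in> words S m - F0. f0 w \<noteq> c}" using x by simp
            then have "x = v" using v by blast
            then show ?thesis using x by simp
          qed (use x in simp)
        qed
        then have "card L0 \<le> card {c, f0 v}" by (intro card_mono) auto
        then have "card (f1 ` B) \<ge> k - 1" using cB vw(3) by simp
        then show ?thesis
          using layers_lower_bound_exception_dead[OF S 2 k34 F f(2) B_def BF _ vw(1) v1 vF] neg by blast
      qed
    qed
  qed
qed

lemma layers_lower_bound:
  assumes S: "finite S" "card S = m + 2" and m: "m \<ge> 2" and k: "k \<in> {2, 3, 4}"
    and F: "F0 \<subseteq> words S m" "F1 \<subseteq> words S m"
    and f: "labelling S m F0 f0" "labelling S m F1 f1"
    and agree: "\<And>x. x \<in> words S m - F0 - F1 \<Longrightarrow> f0 x = f1 x"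
    and many: "card (f0 ` (words S m - F0) \<union> f1 ` (words S m - F1)) \<ge> k + 1"
  shows "card F0 + card F1 \<ge> (2 * m - 2) * k + 4"
proof (cases "card F0 \<le> card F1")
  case True
  then show ?thesis using layers_lower_bound_le[OF S m k F f agree many] by blast
next
  case False
  have "f1 x = f0 x" if "x \<in> words S m - F1 - F0" for x
    using that agree[of x] by auto
  then have "card F1 + card F0 \<ge> (2 * m - 2) * k + 4"
    using False many by (intro layers_lower_bound_le[OF S m k F(2,1) f(2,1)]) (auto simp: Un_commute)
  then show ?thesis by simp
qed

section \<open>The split-star as a two-layer graph\<close>

definition swap_at :: "nat \<Rightarrow> nat \<Rightarrow> nat list \<Rightarrow> nat list" where
  "swap_at a b p = p[a := p ! b, b := p ! a]"

text \<open>Positions count from 1 and everything else is fixed, so that the function permutes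
  \<open>{1..n}\<close> and has a parity.\<close>

definition perm_of :: "nat list \<Rightarrow> nat \<Rightarrow> nat" where
  "perm_of p i = (if i \<in> {1..length p} then p ! (i - 1) else i)"

abbreviation even_word :: "nat list \<Rightarrow> bool" where
  "even_word p \<equiv> evenperm (perm_of p)"

lemma in_split_star_V: "p \<in> split_star_V n \<longleftrightarrow> set p = {1..n} \<and> distinct p"
  by (auto simp: split_star_V_def permutations_of_set_def)

lemma length_split_star: "p \<in> split_star_V n \<Longrightarrow> length p = n"
  using distinct_card[of p] by (auto simp: in_split_star_V)

lemma finite_split_star_V [simp]: "finite (split_star_V n)"
  by (simp add: split_star_V_def)

lemma card_split_star_V: "card (split_star_V n) = fact n"
  by (simp add: split_star_V_def)

lemma perm_of_permutes:
  assumes "p \<in> split_star_V n"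
  shows "perm_of p permutes {1..n}"
proof (rule bij_imp_permutes)
  have l: "length p = n" by (rule length_split_star[OF assms])
  have p: "set p = {1..n}" "distinct p" using assms by (auto simp: in_split_star_V)
  have inj: "inj_on (perm_of p) {1..n}"
    using p(2) l by (auto simp: inj_on_def perm_of_def nth_eq_iff_index_eq)
  have "perm_of p ` {1..n} \<subseteq> {1..n}"
  proof
    fix y assume "y \<in> perm_of p ` {1..n}"
    then obtain i where "i \<in> {1..n}" "y = p ! (i - 1)" using l by (auto simp: perm_of_def)
    then have "y \<in> set p" using l by auto
    then show "y \<in> {1..n}" using p by simp
  qed
  then have "perm_of p ` {1..n} = {1..n}" using inj by (intro endo_inj_surj) auto
  then show "bij_betw (perm_of p) {1..n} {1..n}" using inj by (simp add: bij_betw_def)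
  show "perm_of p x = x" if "x \<notin> {1..n}" for x using that l by (auto simp: perm_of_def)
qed

lemma perm_of_swap_at:
  assumes "a < length p" "b < length p" "a \<noteq> b"
  shows "perm_of (swap_at a b p) = perm_of p \<circ> transpose (a + 1) (b + 1)"
proof
  fix i
  show "perm_of (swap_at a b p) i = (perm_of p \<circ> transpose (a + 1) (b + 1)) i"
  proof (cases "i \<in> {1..length p}")
    case True
    then obtain j where "i = Suc j" "j < length p" by (cases i) auto
    then show ?thesis using assms by (auto simp: perm_of_def swap_at_def transpose_def nth_list_update)
  next
    case False
    then show ?thesis using assms by (auto simp: perm_of_def swap_at_def transpose_def)
  qed
qed

lemma swap_at_in_split_star_V:
  assumes "p \<in> split_star_V n" "a < n" "b < n"
  shows "swap_at a b p \<in> split_star_V n"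
  using assms length_split_star[OF assms(1)]
  by (auto simp: in_split_star_V swap_at_def set_swap distinct_swap)

lemma even_word_swap_at:
  assumes "p \<in> split_star_V n" "a < n" "b < n" "a \<noteq> b"
  shows "even_word (swap_at a b p) \<longleftrightarrow> \<not> even_word p"
proof -
  have "permutation (perm_of p)" using perm_of_permutes[OF assms(1)] permutation_permutes by blast
  then show ?thesis using assms length_split_star[OF assms(1)]
    by (simp add: perm_of_swap_at evenperm_comp permutation_swap_id evenperm_swap)
qed

lemma g12_swap_at: "g12 p = swap_at 0 1 p"
  by (simp add: g12_def swap_at_def)

lemma gplus_swap_at: "length p = n \<Longrightarrow> i \<in> {3..n} \<Longrightarrow> gplus i p = swap_at 0 (i - 1) (swap_at 0 1 p)"
  unfolding gplus_def swap_at_def by (intro nth_equalityI) (auto simp: nth_update_if)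

lemma gminus_swap_at: "length p = n \<Longrightarrow> i \<in> {3..n} \<Longrightarrow> gminus i p = swap_at 1 (i - 1) (swap_at 0 1 p)"
  unfolding gminus_def swap_at_def by (intro nth_equalityI) (auto simp: nth_update_if)

lemma generators_in_split_star_V:
  assumes "p \<in> split_star_V n" "n \<ge> 3"
  shows "g12 p \<in> split_star_V n" "i \<in> {3..n} \<Longrightarrow> gplus i p \<in> split_star_V n" "i \<in> {3..n} \<Longrightarrow> gminus i p \<in> split_star_V n"
  using assms length_split_star[OF assms(1)]
  by (auto simp: g12_swap_at gplus_swap_at gminus_swap_at intro!: swap_at_in_split_star_V)

text \<open>\<open>g12\<close> is one transposition of positions and the other generators are
  products of two, so the layers are the parity classes.\<close>

lemma generators_even_word:
  assumes "p \<in> split_star_V n" "n \<ge> 3"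
  shows "even_word (g12 p) \<longleftrightarrow> \<not> even_word p" "i \<in> {3..n} \<Longrightarrow> even_word (gplus i p) \<longleftrightarrow> even_word p"
    "i \<in> {3..n} \<Longrightarrow> even_word (gminus i p) \<longleftrightarrow> even_word p"
proof -
  have s: "swap_at 0 1 p \<in> split_star_V n" by (rule swap_at_in_split_star_V) (use assms in auto)
  note l = length_split_star[OF assms(1)]
  have i: "i - 1 < n" "0 \<noteq> i - 1" "1 \<noteq> i - 1" if "i \<in> {3..n}" using that by auto
  show "even_word (g12 p) \<longleftrightarrow> \<not> even_word p"
    using even_word_swap_at[OF assms(1), of 0 1] assms(2) by (simp add: g12_swap_at)
  show "even_word (gplus i p) \<longleftrightarrow> even_word p" if "i \<in> {3..n}"
    using even_word_swap_at[OF assms(1), of 0 1] even_word_swap_at[OF s _ i(1,2)[OF that]] assms(2)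
      gplus_swap_at[OF l that] by simp
  show "even_word (gminus i p) \<longleftrightarrow> even_word p" if "i \<in> {3..n}"
    using even_word_swap_at[OF assms(1), of 0 1] even_word_swap_at[OF s _ i(1,3)[OF that]] assms(2)
      gminus_swap_at[OF l that] by simp
qed

lemma split_star_E_in_V:
  assumes "p \<in> split_star_V n" "n \<ge> 3" "split_star_E n p q"
  shows "q \<in> split_star_V n"
  using assms(3) generators_in_split_star_V[OF assms(1,2)] by (auto simp: split_star_E_def)

lemma split_star_E_sym:
  assumes "p \<in> split_star_V n" "n \<ge> 3" "split_star_E n p q"
  shows "split_star_E n q p"
proof -
  have l: "length p = n" by (rule length_split_star[OF assms(1)])
  have 1: "p = g12 (g12 p)" using l assms(2)
    unfolding g12_def by (intro nth_equalityI) (auto simp: nth_update_if)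
  have 2: "p = gminus i (gplus i p)" "p = gplus i (gminus i p)" if "i \<in> {3..n}" for i using l that
    unfolding gplus_def gminus_def by (auto intro!: nth_equalityI simp: nth_update_if)
  show ?thesis using assms(3) 1 2 unfolding split_star_E_def by metis
qed

section \<open>Vertices as pairs of a tail and a parity\<close>

lemma split_star_V_Cons2:
  assumes "w \<in> words {1..n} m" "n = m + 2" "{1..n} - set w = {a, b}" "a \<noteq> b"
  shows "a # b # w \<in> split_star_V n"
  using assms by (auto simp: in_split_star_V words_def)

lemma drop2_in_words:
  assumes "p \<in> split_star_V n" "n = m + 2"
  obtains a b where "p = a # b # drop 2 p" "drop 2 p \<in> words {1..n} m" "{1..n} - set (drop 2 p) = {a, b}" "a \<noteq> b"
proof -
  have l: "length p = Suc (Suc m)" using length_split_star[OF assms(1)] assms(2) by simp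
  then obtain a b w where p: "p = a # b # w" by (auto simp: length_Suc_conv)
  then have "drop 2 p = w" by simp
  moreover have "w \<in> words {1..n} m" "{1..n} - set w = {a, b}" "a \<noteq> b"
    using assms(1) l p by (auto simp: in_split_star_V words_def)
  ultimately show ?thesis using that p by metis
qed

text \<open>The tail determines the first two symbols up to order, and the two orders differ by
  \<open>g12\<close>, hence in parity.\<close>

lemma ex1_vertex:
  assumes "w \<in> words {1..n} m" "n = m + 2" "m \<ge> 1"
  shows "\<exists>!p. p \<in> split_star_V n \<and> drop 2 p = w \<and> even_word p = e"
proof -
  obtain a b where ab: "{1..n} - set w = {a, b}" "a \<noteq> b"
    using card_unused[OF assms(1)] assms(2) by (auto simp: card_2_iff)
  define p where "p = a # b # w"
  define q where "q = b # a # w"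
  have pV: "p \<in> split_star_V n" unfolding p_def by (rule split_star_V_Cons2[OF assms(1,2) ab])
  have qV: "q \<in> split_star_V n" unfolding q_def
    by (rule split_star_V_Cons2[OF assms(1,2)]) (use ab in auto)
  have "q = g12 p" by (simp add: p_def q_def g12_def)
  then have par: "even_word q \<longleftrightarrow> \<not> even_word p" using generators_even_word(1)[OF pV] assms by simp
  have only: "x = p \<or> x = q" if x: "x \<in> split_star_V n" "drop 2 x = w" for x
  proof -
    obtain c d where cd: "x = c # d # w" "{1..n} - set w = {c, d}" "c \<noteq> d"
      using drop2_in_words[OF x(1) assms(2)] x(2) by metis
    then have "{c, d} = {a, b}" using ab by simp
    then show ?thesis using cd(1,3) by (auto simp: p_def q_def doubleton_eq_iff)
  qed
  have dr: "drop 2 p = w" "drop 2 q = w" by (simp_all add: p_def q_def)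
  show ?thesis
  proof (cases "even_word p = e")
    case True
    show ?thesis by (rule ex1I[of _ p]) (use True pV dr only par in auto)
  next
    case False
    show ?thesis by (rule ex1I[of _ q]) (use False qV dr only par in auto)
  qed
qed

definition vertex :: "nat \<Rightarrow> bool \<Rightarrow> nat list \<Rightarrow> nat list" where
  "vertex n e w = (THE p. p \<in> split_star_V n \<and> drop 2 p = w \<and> even_word p = e)"

lemma vertex:
  assumes "w \<in> words {1..n} m" "n = m + 2" "m \<ge> 1"
  shows "vertex n e w \<in> split_star_V n" "drop 2 (vertex n e w) = w" "even_word (vertex n e w) = e"
  using theI'[OF ex1_vertex[OF assms, of e]] by (auto simp: vertex_def)

lemma vertex_eqI:
  assumes "w \<in> words {1..n} m" "n = m + 2" "m \<ge> 1" "p \<in> split_star_V n" "drop 2 p = w" "even_word p = e"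
  shows "vertex n e w = p"
  unfolding vertex_def by (rule the1_equality[OF ex1_vertex[OF assms(1-3)]]) (use assms in auto)

lemma split_star_E_layers:
  assumes "w \<in> words {1..n} m" "n = m + 2" "m \<ge> 1"
  shows "split_star_E n (vertex n e w) (vertex n (\<not> e) w)"
proof -
  let ?p = "vertex n e w"
  note v = vertex[OF assms, of e]
  have n3: "n \<ge> 3" using assms by simp
  have "vertex n (\<not> e) w = g12 ?p"
  proof (rule vertex_eqI[OF assms])
    show "g12 ?p \<in> split_star_V n" by (rule generators_in_split_star_V(1)[OF v(1) n3])
    show "drop 2 (g12 ?p) = w" using v(2) by (simp add: g12_def drop_update_cancel)
    show "even_word (g12 ?p) = (\<not> e)" using generators_even_word(1)[OF v(1) n3] v(3) by simp
  qed
  then show ?thesis by (simp add: split_star_E_def)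
qed

lemma split_star_E_near:
  assumes "w \<in> words {1..n} m" "z \<in> words {1..n} m" "n = m + 2" "m \<ge> 1" "near w z" "w \<noteq> z"
  shows "split_star_E n (vertex n e w) (vertex n e z)"
proof -
  let ?p = "vertex n e w"
  note v = vertex[OF assms(1,3,4), of e]
  have n3: "n \<ge> 3" using assms by simp
  have l: "length w = m" using assms(1) by (simp add: words_def)
  obtain i where i: "i < m" "z = w[i := z ! i]" "z ! i \<noteq> w ! i"
    using near_imp_update[OF assms(5,6)] l by metis
  have x: "z ! i \<in> {1..n} - set w"
    by (rule update_in_wordsD[OF assms(1) i(1) _ i(3)]) (use i(2) assms(2) in simp)
  obtain a b where ab: "?p = a # b # w" "{1..n} - set w = {a, b}"
    using drop2_in_words[OF v(1) assms(3)] v(2) by metis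
  \<comment> \<open>Letter \<open>i\<close> of the tail, counted from 0, is position
    \<open>i + 3\<close> of the permutation, counted from 1.\<close>
  have i3: "i + 3 \<in> {3..n}" using i assms(3) by auto
  have pl: "gplus (i + 3) ?p = w ! i # a # w[i := b]" unfolding ab(1) gplus_def by (simp add: numeral_eq_Suc)
  have mi: "gminus (i + 3) ?p = b # w ! i # w[i := a]" unfolding ab(1) gminus_def by (simp add: numeral_eq_Suc)
  have "z ! i = a \<or> z ! i = b" using x ab(2) by blast
  then show ?thesis
  proof
    assume zi: "z ! i = b"
    have "vertex n e z = gplus (i + 3) ?p"
    proof (rule vertex_eqI[OF assms(2-4)])
      show "gplus (i + 3) ?p \<in> split_star_V n" by (rule generators_in_split_star_V(2)[OF v(1) n3 i3])
      show "drop 2 (gplus (i + 3) ?p) = z" unfolding pl using i(2) zi by simp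
      show "even_word (gplus (i + 3) ?p) = e" using generators_even_word(2)[OF v(1) n3 i3] v(3) by simp
    qed
    then show ?thesis using i3 unfolding split_star_E_def by blast
  next
    assume zi: "z ! i = a"
    have "vertex n e z = gminus (i + 3) ?p"
    proof (rule vertex_eqI[OF assms(2-4)])
      show "gminus (i + 3) ?p \<in> split_star_V n" by (rule generators_in_split_star_V(3)[OF v(1) n3 i3])
      show "drop 2 (gminus (i + 3) ?p) = z" unfolding mi using i(2) zi by simp
      show "even_word (gminus (i + 3) ?p) = e" using generators_even_word(3)[OF v(1) n3 i3] v(3) by simp
    qed
    then show ?thesis using i3 unfolding split_star_E_def by blast
  qed
qed

lemma split_star_lower_bound:
  assumes n: "n \<ge> 4" and k: "k \<in> {2, 3, 4}" and F: "F \<subseteq> split_star_V n"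
    and f: "\<And>x y. x \<in> split_star_V n - F \<Longrightarrow> y \<in> split_star_V n - F \<Longrightarrow> split_star_E n x y \<Longrightarrow> f x = f y"
    and many: "card (f ` (split_star_V n - F)) \<ge> k + 1"
  shows "card F \<ge> (2 * n - 6) * k + 4"
proof -
  define m where "m = n - 2"
  have m: "n = m + 2" "m \<ge> 2" "m \<ge> 1" using n by (auto simp: m_def)
  define W where "W = words {1..n} m"
  define G where "G e = {w \<in> W. vertex n e w \<in> F}" for e
  define g where "g e w = f (vertex n e w)" for e w
  have vV: "vertex n e w \<in> split_star_V n" if "w \<in> W" for e w using vertex(1)[OF _ m(1,3)] that by (simp add: W_def)
  have lab: "labelling {1..n} m (G e) (g e)" for e
    unfolding labelling_def W_def[symmetric]
  proof (intro ballI impI)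
    fix w z assume wz: "w \<in> W - G e" "z \<in> W - G e" "near w z"
    show "g e w = g e z"
    proof (cases "w = z")
      case False
      then have "split_star_E n (vertex n e w) (vertex n e z)"
        using wz by (intro split_star_E_near[OF _ _ m(1,3)]) (auto simp: W_def)
      then show ?thesis unfolding g_def using wz vV by (intro f) (auto simp: G_def)
    qed simp
  qed
  have agree: "g False w = g True w" if "w \<in> W - G False - G True" for w
  proof -
    have "split_star_E n (vertex n False w) (vertex n (\<not> False) w)"
      by (rule split_star_E_layers[OF _ m(1,3)]) (use that in \<open>auto simp: W_def\<close>)
    then show ?thesis unfolding g_def using that vV by (intro f) (auto simp: G_def)
  qed
  have sub: "f ` (split_star_V n - F) \<subseteq> g False ` (W - G False) \<union> g True ` (W - G True)"
  proof
    fix y assume "y \<in> f ` (split_star_V n - F)"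
    then obtain p where p: "p \<in> split_star_V n" "p \<notin> F" "y = f p" by blast
    obtain "drop 2 p \<in> W" using drop2_in_words[OF p(1) m(1)] by (metis W_def)
    moreover from this have "vertex n (even_word p) (drop 2 p) = p"
      by (intro vertex_eqI[OF _ m(1,3) p(1)]) (auto simp: W_def)
    ultimately have "y \<in> g (even_word p) ` (W - G (even_word p))"
      using p by (auto simp: g_def G_def intro!: image_eqI[of _ _ "drop 2 p"])
    then show "y \<in> g False ` (W - G False) \<union> g True ` (W - G True)" by (cases "even_word p") auto
  qed
  have finW: "finite W" by (simp add: W_def)
  have "k + 1 \<le> card (g False ` (W - G False) \<union> g True ` (W - G True))"
    using many card_mono[OF _ sub] finW by simp
  then have "card (G False) + card (G True) \<ge> (2 * m - 2) * k + 4"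
    unfolding W_def
    by (intro layers_lower_bound[OF _ _ m(2) k _ _ lab lab agree]) (use m in \<open>auto simp: G_def W_def\<close>)
  moreover have "card (G False) + card (G True) \<le> card F"
  proof -
    have inj: "inj_on (vertex n e) (G e)" for e
      by (rule inj_on_inverseI[of _ "drop 2"]) (auto simp: G_def W_def vertex(2)[OF _ m(1,3)])
    have "vertex n False ` G False \<inter> vertex n True ` G True = {}"
    proof -
      have "\<not> even_word p" if "p \<in> vertex n False ` G False" for p
        using that vertex(3)[OF _ m(1,3), of _ False] by (auto simp: G_def W_def)
      moreover have "even_word p" if "p \<in> vertex n True ` G True" for p
        using that vertex(3)[OF _ m(1,3), of _ True] by (auto simp: G_def W_def)
      ultimately show ?thesis by blast
    qed
    then have "card (vertex n False ` G False \<union> vertex n True ` G True) = card (G False) + card (G True)"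
      using finW by (subst card_Un_disjoint) (auto simp: G_def card_image[OF inj, unfolded G_def])
    moreover have "vertex n False ` G False \<union> vertex n True ` G True \<subseteq> F" by (auto simp: G_def)
    ultimately show ?thesis using card_mono[OF finite_subset[OF F]] by (metis finite_split_star_V)
  qed
  ultimately show ?thesis using m(1) by simp
qed

lemma components_del_eq: "components_del V E F = (\<lambda>x. {y. reach_del V E F x y}) ` (V - F)"
  by (auto simp: components_del_def quotient_def)

text \<open>Mapping each vertex to its reachability class is a labelling; symmetry of the edges
  makes the classes of both ends equal.\<close>

lemma split_star_components_lower_bound:
  assumes n: "n \<ge> 4" and k: "k \<in> {2, 3, 4}" and F: "F \<subseteq> split_star_V n"
    and many: "card (components_del (split_star_V n) (split_star_E n) F) \<ge> k + 1"
  shows "card F \<ge> (2 * n - 6) * k + 4"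
proof (rule split_star_lower_bound[OF n k F])
  let ?r = "reach_del (split_star_V n) (split_star_E n) F"
  show "card ((\<lambda>x. {y. ?r x y}) ` (split_star_V n - F)) \<ge> k + 1"
    using many by (simp add: components_del_eq)
  fix x y assume xy: "x \<in> split_star_V n - F" "y \<in> split_star_V n - F" "split_star_E n x y"
  have "split_star_E n y x" using split_star_E_sym[OF _ _ xy(3)] xy(1) n by simp
  then have "?r x y" "?r y x" using xy unfolding reach_del_def by (auto intro!: r_into_rtranclp)
  then show "{z. ?r x z} = {z. ?r y z}" unfolding reach_del_def by (auto intro: rtranclp_trans)
qed

section \<open>Isolating four vertices\<close>

text \<open>The map \<open>g\<close> keeps the points of \<open>A\<close> apart and sends all others
  to \<open>None\<close>. It is constant along surviving edges and takes \<open>card A + 1\<close>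
  values, the last one at \<open>z\<close>, which bounds the number of components without
  determining them.\<close>

lemma isolated_components:
  assumes V: "finite V" and sym: "\<And>x y. x \<in> V \<Longrightarrow> E x y \<Longrightarrow> E y x"
    and A: "A \<subseteq> V" and AF: "A \<inter> F = {}" and nb: "\<And>a x. a \<in> A \<Longrightarrow> E a x \<Longrightarrow> x \<in> F"
    and z: "z \<in> V - F - A"
  shows "card (components_del V E F) \<ge> card A + 1"
proof -
  define g where "g x = (if x \<in> A then Some x else None)" for x
  have step: "g x = g y" if "x \<in> V - F" "y \<in> V - F" "E x y" for x y
  proof -
    have "x \<notin> A" using that nb by blast
    moreover have "y \<notin> A" using that nb sym by blast
    ultimately show ?thesis by (simp add: g_def)
  qed
  have reach: "g x = g y" if "reach_del V E F x y" for x y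
    using that unfolding reach_del_def
  proof (induction rule: rtranclp_induct)
    case (step y z)
    then show ?case using \<open>\<And>x y. x \<in> V - F \<Longrightarrow> y \<in> V - F \<Longrightarrow> E x y \<Longrightarrow> g x = g y\<close>[of y z] by simp
  qed simp
  have "card (g ` (V - F)) \<le> card ((\<lambda>x. {y. reach_del V E F x y}) ` (V - F))"
  proof (rule card_image_factor_le)
    fix x y assume "{z. reach_del V E F x z} = {z. reach_del V E F y z}"
    moreover have "reach_del V E F y y" by (simp add: reach_del_def)
    ultimately have "reach_del V E F x y" by blast
    then show "g x = g y" by (rule reach)
  qed (use V in simp)
  moreover have "insert None (Some ` A) \<subseteq> g ` (V - F)"
  proof -
    have "None \<in> g ` (V - F)" using z by (auto simp: g_def intro!: image_eqI[of _ _ z])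
    moreover have "Some a \<in> g ` (V - F)" if "a \<in> A" for a
      using that A AF by (auto simp: g_def intro!: image_eqI[of _ _ a])
    ultimately show ?thesis by blast
  qed
  then have "card (insert None (Some ` A)) \<le> card (g ` (V - F))" by (rule card_mono[rotated]) (simp add: V)
  moreover have "card (insert None (Some ` A)) = card A + 1"
    using finite_subset[OF A V] by (simp add: card_image)
  ultimately show ?thesis by (simp add: components_del_eq)
qed

section \<open>Neighbours of permutations with tail 5, ..., n\<close>

definition nbrs :: "nat \<Rightarrow> nat list \<Rightarrow> nat list set" where
  "nbrs n p = {q. split_star_E n p q}"

lemma card_nbrs:
  assumes "n \<ge> 3"
  shows "finite (nbrs n p)" "card (nbrs n p) \<le> 2 * n - 3"
proof -
  have e: "nbrs n p = insert (g12 p) ((\<lambda>i. gplus i p) ` {3..n} \<union> (\<lambda>i. gminus i p) ` {3..n})"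
    by (auto simp: nbrs_def split_star_E_def)
  show "finite (nbrs n p)" unfolding e by simp
  have "card ((\<lambda>i. gplus i p) ` {3..n} \<union> (\<lambda>i. gminus i p) ` {3..n}) \<le> (n - 2) + (n - 2)"
    using card_Un_le[of "(\<lambda>i. gplus i p) ` {3..n}" "(\<lambda>i. gminus i p) ` {3..n}"]
      card_image_le[of "{3..n}" "\<lambda>i. gplus i p"] card_image_le[of "{3..n}" "\<lambda>i. gminus i p"] by simp
  moreover have "card (nbrs n p) \<le> Suc (card ((\<lambda>i. gplus i p) ` {3..n} \<union> (\<lambda>i. gminus i p) ` {3..n}))"
    unfolding e by (rule card_insert_le_m1) auto
  ultimately show "card (nbrs n p) \<le> 2 * n - 3" using assms by linarith
qed

lemma generators_prefix4:
  "g12 ([a, b, c, d] @ r) = [b, a, c, d] @ r"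
  "gplus 3 ([a, b, c, d] @ r) = [c, a, b, d] @ r" "gminus 3 ([a, b, c, d] @ r) = [b, c, a, d] @ r"
  "gplus 4 ([a, b, c, d] @ r) = [d, a, c, b] @ r" "gminus 4 ([a, b, c, d] @ r) = [b, d, c, a] @ r"
  by (simp_all add: g12_def gplus_def gminus_def numeral_eq_Suc)

text \<open>A generator with \<open>i\<close> at least 5 moves one of the first two symbols, which
  are at most 4, into position \<open>i\<close> and so destroys the tail. What is left are five
  rearrangements of the prefix.\<close>

lemma nbrs_prefix4_iff:
  fixes a b c d a' b' c' d' n :: nat
  assumes "n \<ge> 4" "a \<le> 4" "b \<le> 4"
  shows "[a', b', c', d'] @ [5..<n + 1] \<in> nbrs n ([a, b, c, d] @ [5..<n + 1]) \<longleftrightarrow>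
    [a', b', c', d'] \<in> {[b, a, c, d], [c, a, b, d], [b, c, a, d], [d, a, c, b], [b, d, c, a]}"
    (is "?q \<in> nbrs n ?p \<longleftrightarrow> _")
proof
  have far: "gplus i ?p \<noteq> ?q \<and> gminus i ?p \<noteq> ?q" if i: "i \<in> {5..n}" for i
  proof -
    have "?q ! (i - 1) = i" using i by (auto simp: nth_append)
    moreover have "gplus i p ! (i - 1) = p ! 1" "gminus i p ! (i - 1) = p ! 0" if "i - 1 < length p" for p
      using that by (simp_all add: gplus_def gminus_def)
    from this[of ?p] have "gplus i ?p ! (i - 1) = b" "gminus i ?p ! (i - 1) = a" using i by auto
    ultimately show ?thesis using i assms by auto
  qed
  assume "?q \<in> nbrs n ?p"
  then consider "?q = g12 ?p" | i where "i \<in> {3..n}" "?q = gplus i ?p \<or> ?q = gminus i ?p"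
    by (auto simp: nbrs_def split_star_E_def)
  then show "[a', b', c', d'] \<in> {[b, a, c, d], [c, a, b, d], [b, c, a, d], [d, a, c, b], [b, d, c, a]}"
  proof cases
    case 1
    then show ?thesis unfolding generators_prefix4 by simp
  next
    case (2 i)
    then consider "i = 3" | "i = 4" | "i \<in> {5..n}" by fastforce
    then show ?thesis
    proof cases
      case 1
      then show ?thesis using 2(2) unfolding 1 generators_prefix4 by auto
    next
      case i4: 2
      then show ?thesis using 2(2) unfolding i4 generators_prefix4 by auto
    next
      case 3
      then show ?thesis using far[OF 3] 2(2) by metis
    qed
  qed
next
  assume "[a', b', c', d'] \<in> {[b, a, c, d], [c, a, b, d], [b, c, a, d], [d, a, c, b], [b, d, c, a]}"
  moreover have "3 \<in> {3..n}" "4 \<in> {3..n}" using assms by auto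
  then have "g12 ?p \<in> nbrs n ?p" "gplus 3 ?p \<in> nbrs n ?p" "gminus 3 ?p \<in> nbrs n ?p"
    "gplus 4 ?p \<in> nbrs n ?p" "gminus 4 ?p \<in> nbrs n ?p"
    unfolding nbrs_def split_star_E_def by blast+
  ultimately show "?q \<in> nbrs n ?p" unfolding generators_prefix4 by auto
qed

lemma prefix4_in_split_star_V:
  assumes "n \<ge> 4" "{a, b, c, d} = {1, 2, 3, 4}" "distinct [a, b, c, d]"
  shows "[a, b, c, d] @ [5..<n + 1] \<in> split_star_V n"
proof -
  have p: "set [a, b, c, d] = {1, 2, 3, 4}" using assms(2) by simp
  have "set ([a, b, c, d] @ [5..<n + 1]) = {1, 2, 3, 4} \<union> {5..<n + 1}" by (simp only: set_append p set_upt)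
  also have "\<dots> = {1..n}" using assms(1) by auto
  finally have "set ([a, b, c, d] @ [5..<n + 1]) = {1..n}" .
  moreover have "distinct ([a, b, c, d] @ [5..<n + 1])"
    unfolding distinct_append p set_upt using assms(3) by simp
  ultimately show ?thesis unfolding in_split_star_V by blast
qed

lemma card_Un_common_le:
  assumes "finite A" "finite B" "C \<subseteq> A \<inter> B" "card A \<le> a" "card B \<le> b"
  shows "card (A \<union> B) + card C \<le> a + b"
  using card_Un_Int[OF assms(1,2)] card_mono[OF _ assms(3)] assms by simp

text \<open>Modulo the matching, the four isolated vertices form a 4-cycle that alternates between the two
  layers: 1234 and 4321 are even, 1324 and 4231 are odd.\<close>

lemma split_star_upper_bound:
  assumes n: "n \<ge> 4" and k: "k \<in> {2, 3, 4}"
  shows "\<exists>F. F \<subseteq> split_star_V n \<and> card F \<le> (2 * n - 6) * k + 4 \<and>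
    card (components_del (split_star_V n) (split_star_E n) F) \<ge> k + 1"
proof -
  define r where "r = [5..<n + 1]"
  \<comment> \<open>Initial segments of one list serve all three \<open>k\<close>. Each new vertex
    shares 2, then 3, then 3 neighbours with the earlier ones, which yields the deductions 2, 5 and
    8.\<close>
  define A where "A = set (take k [[1, 2, 3, 4] @ r, [1, 3, 2, 4] @ r, [4, 2, 3, 1] @ r, [4, 3, 2, 1] @ r])"
  define F where "F = (\<Union>a\<in>A. nbrs n a)"
  note iff = nbrs_prefix4_iff[OF n, folded r_def]
  let ?N1 = "nbrs n ([1, 2, 3, 4] @ r)" and ?N2 = "nbrs n ([1, 3, 2, 4] @ r)"
    and ?N3 = "nbrs n ([4, 2, 3, 1] @ r)" and ?N4 = "nbrs n ([4, 3, 2, 1] @ r)"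
  have N: "finite (nbrs n p)" "card (nbrs n p) \<le> 2 * n - 3" for p using card_nbrs n by auto
  have A4: "A \<subseteq> {[1, 2, 3, 4] @ r, [1, 3, 2, 4] @ r, [4, 2, 3, 1] @ r, [4, 3, 2, 1] @ r}"
    unfolding A_def by (auto dest!: in_set_takeD)
  have AV: "A \<subseteq> split_star_V n"
  proof -
    have "[1, 2, 3, 4] @ r \<in> split_star_V n" "[1, 3, 2, 4] @ r \<in> split_star_V n"
      "[4, 2, 3, 1] @ r \<in> split_star_V n" "[4, 3, 2, 1] @ r \<in> split_star_V n"
      unfolding r_def by (rule prefix4_in_split_star_V[OF n]; auto)+
    then show ?thesis using A4 by blast
  qed
  have FV: "F \<subseteq> split_star_V n"
    using AV split_star_E_in_V n by (auto simp: F_def nbrs_def)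
  have cA: "card A = k" using k by (auto simp: A_def)
  have AF: "A \<inter> F = {}"
  proof -
    have "a \<notin> nbrs n b" if "a \<in> A" "b \<in> A" for a b
      using subsetD[OF A4 that(1)] subsetD[OF A4 that(2)] by (auto simp: iff simp del: append.simps)
    then show ?thesis by (auto simp: F_def)
  qed
  \<comment> \<open>One more survivor, for a component besides the \<open>k\<close> isolated
    vertices.\<close>
  have z: "[2, 1, 4, 3] @ r \<in> split_star_V n - F - A"
  proof -
    have "[2, 1, 4, 3] @ r \<in> split_star_V n" unfolding r_def by (rule prefix4_in_split_star_V[OF n]) auto
    moreover have "[2, 1, 4, 3] @ r \<notin> nbrs n b" if "b \<in> A" for b
      using subsetD[OF A4 that] by (auto simp: iff simp del: append.simps)
    moreover have "[2, 1, 4, 3] @ r \<notin> A" using subsetD[OF A4, of "[2, 1, 4, 3] @ r"] by auto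
    ultimately show ?thesis unfolding F_def by blast
  qed
  have c2: "card (?N1 \<union> ?N2) \<le> 4 * n - 8"
  proof -
    have "card (?N1 \<union> ?N2) + card {[3, 1, 2, 4] @ r, [2, 1, 3, 4] @ r} \<le> (2 * n - 3) + (2 * n - 3)"
      by (rule card_Un_common_le[OF N(1) N(1) _ N(2) N(2)]) (auto simp: iff simp del: append.simps)
    then show ?thesis by simp
  qed
  have c3: "card (?N1 \<union> ?N2 \<union> ?N3) \<le> 6 * n - 14"
  proof -
    have "card (?N1 \<union> ?N2 \<union> ?N3) + card {[2, 4, 3, 1] @ r, [2, 1, 3, 4] @ r, [3, 4, 2, 1] @ r} \<le> (4 * n - 8) + (2 * n - 3)"
      by (rule card_Un_common_le[OF _ N(1) _ c2 N(2)]) (auto simp: iff N(1) simp del: append.simps)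
    then show ?thesis by simp
  qed
  have c4: "card (?N1 \<union> ?N2 \<union> ?N3 \<union> ?N4) \<le> 8 * n - 20"
  proof -
    have "card (?N1 \<union> ?N2 \<union> ?N3 \<union> ?N4) + card {[3, 4, 2, 1] @ r, [2, 4, 3, 1] @ r, [3, 1, 2, 4] @ r} \<le> (6 * n - 14) + (2 * n - 3)"
      by (rule card_Un_common_le[OF _ N(1) _ c3 N(2)]) (auto simp: iff N(1) simp del: append.simps)
    then show ?thesis by simp
  qed
  have "card F \<le> (2 * n - 6) * k + 4"
    using k c2 c3 c4 n unfolding F_def A_def by (auto simp: diff_mult_distrib Un_ac)
  moreover have "card (components_del (split_star_V n) (split_star_E n) F) \<ge> card A + 1"
    by (rule isolated_components[OF finite_split_star_V _ AV AF _ z])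
      (use split_star_E_sym n in \<open>auto simp: F_def nbrs_def\<close>)
  ultimately show ?thesis using FV cA by auto
qed

text \<open>Handles the other alternative in \<open>comp_conn\<close>: leaving fewer than
  \<open>k + 1\<close> vertices takes more than \<open>fact n - (k + 1)\<close> faults, which is no
  cheaper.\<close>

lemma fact_ge_linear:
  assumes "n \<ge> (4 :: nat)"
  shows "fact n \<ge> 8 * n - 8"
  using assms
proof (induction n rule: dec_induct)
  case (step n)
  have "2 * fact n \<le> Suc n * (fact n :: nat)" using step(1) by (intro mult_right_mono) auto
  moreover have "fact (Suc n) = Suc n * (fact n :: nat)" by simp
  ultimately have "fact (Suc n) \<ge> 2 * (8 * n - 8)" using step(3) by linarith
  then show ?case using step(1) by simp
qed (simp add: numeral_eq_Suc)

lemma comp_conn_split_star: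
  assumes n: "n \<ge> 4" and k: "k \<in> {2, 3, 4}"
  shows "comp_conn (k + 1) (split_star_V n) (split_star_E n) = (2 * n - 6) * k + 4"
  unfolding comp_conn_def
proof (rule Least_equality)
  let ?C = "components_del (split_star_V n) (split_star_E n)"
  have lower: "card F \<ge> (2 * n - 6) * k + 4"
    if F: "F \<subseteq> split_star_V n" and "card (?C F) \<ge> k + 1 \<or> card (split_star_V n - F) < k + 1" for F
    using that(2)
  proof
    assume "card (?C F) \<ge> k + 1"
    then show ?thesis by (rule split_star_components_lower_bound[OF n k F])
  next
    assume "card (split_star_V n - F) < k + 1"
    then have "fact n < card F + (k + 1)"
      using card_Diff_subset[OF finite_subset[OF F] F] card_split_star_V[of n] by simp
    moreover have "(2 * n - 6) * k + 4 + k \<le> 8 * n - 8" using k n by (auto simp: diff_mult_distrib)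
    ultimately show ?thesis using fact_ge_linear[OF n] by linarith
  qed
  obtain F where F: "F \<subseteq> split_star_V n" "card F \<le> (2 * n - 6) * k + 4" "card (?C F) \<ge> k + 1"
    using split_star_upper_bound[OF n k] by metis
  then have "card F = (2 * n - 6) * k + 4" using lower[of F] by linarith
  then show "\<exists>F. F \<subseteq> split_star_V n \<and> card F = (2 * n - 6) * k + 4 \<and>
      (k + 1 \<le> card (?C F) \<or> card (split_star_V n - F) < k + 1)"
    using F by blast
  show "(2 * n - 6) * k + 4 \<le> y"
    if "\<exists>F. F \<subseteq> split_star_V n \<and> card F = y \<and> (k + 1 \<le> card (?C F) \<or> card (split_star_V n - F) < k + 1)" for y
    using that lower by blast
qed

theorem theorem2:
  fixes n :: nat
  assumes "n \<ge> 4"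
  shows "comp_conn 3 (split_star_V n) (split_star_E n) = 4 * n - 8
       \<and> comp_conn 4 (split_star_V n) (split_star_E n) = 6 * n - 14
       \<and> comp_conn 5 (split_star_V n) (split_star_E n) = 8 * n - 20"
  using comp_conn_split_star[OF assms, of 2] comp_conn_split_star[OF assms, of 3]
    comp_conn_split_star[OF assms, of 4] assms by (simp add: diff_mult_distrib)


end
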